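(* Let $\beta$ be a cubic Pisot unit (a Pisot unit of degree $3$) satisfying property (F) and such that the number field $\mathbb{Q}(\beta)$ is not totally real. Then $\gamma(\beta)$ is irrational. In particular, $0<\gamma(\beta)<1$.
   Context: For a real number $\beta>1$, the $\beta$-transformation is $T_\beta: x\mapsto \beta x-\lfloor\beta x\rfloor$. The $\beta$-expansion of $\xi\in[0,1)$ is the sequence $d_\beta(\xi)=(a_n)_{n\ge1}$ with $a_n=\lfloor\beta T_\beta^{n-1}(\xi)\rfloor\in\{0,1,\ldots,\lceil\beta\rceil-1\}$, so that $\xi=\sum_{n\ge1}a_n\beta^{-n}$. A sequence $(a_n)_{n\ge1}$ is purely periodic if there is a positive integer $p$ with $a_{n+p}=a_n$ for every $n\ge1$. Define $$\gamma(\beta):=\sup\{c\in[0,1)\mid \text{for every rational number } p/q \text{ with } 0\le p/q\le c,\ d_\beta(p/q)\text{ is purely periodic}\}.$$ A Pisot number is a real algebraic integer greater than $1$ whose Galois conjugates different from itself all have modulus less than $1$. A Pisot unit is a Pisot number that is a unit of the ring of integers of the number field it generates. Property (F) for $\beta$: every $x\in\mathbb{Z}[1/\beta]\cap[0,1)$ has a finite $\beta$-expansion, i.e. $d_\beta(x)$ has only finitely many nonzero terms. *)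

theory Defs
  imports Complex_Main "HOL-Computational_Algebra.Computational_Algebra" "HOL.Hull"
begin

section \<open>Beta-expansions\<close>

definition beta_transformation :: "real \<Rightarrow> real \<Rightarrow> real" where
  "beta_transformation \<beta> x = \<beta> * x - of_int \<lfloor>\<beta> * x\<rfloor>"

text \<open>
  Infinite sequences \<open>a\<^sub>1, a\<^sub>2, \<dots>\<close> are functions on the natural numbers of which only the
  values at indices \<open>n \<ge> 1\<close> are used; the value at \<open>0\<close> is irrelevant.
\<close>

definition beta_expansion :: "real \<Rightarrow> real \<Rightarrow> nat \<Rightarrow> int" where
  "beta_expansion \<beta> \<xi> n = \<lfloor>\<beta> * (beta_transformation \<beta> ^^ (n - 1)) \<xi>\<rfloor>"

definition purely_periodic :: "(nat \<Rightarrow> 'a) \<Rightarrow> bool" where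
  "purely_periodic a \<longleftrightarrow> (\<exists>p>0. \<forall>n\<ge>1. a (n + p) = a n)"

text \<open>The set below contains \<open>0\<close> and is bounded by \<open>1\<close>, so the supremum is a genuine one.\<close>

definition gamma_beta :: "real \<Rightarrow> real" where
  "gamma_beta \<beta> =
     Sup {c \<in> {0..<1}. \<forall>r\<in>\<rat>. 0 \<le> r \<and> r \<le> c \<longrightarrow> purely_periodic (beta_expansion \<beta> r)}"

text \<open>The ring \<open>\<int>[x]\<close>.\<close>

definition int_adjoin :: "real \<Rightarrow> real set" where
  "int_adjoin x = range (\<lambda>p :: int poly. poly (map_poly of_int p) x)"

definition property_F :: "real \<Rightarrow> bool" where
  "property_F \<beta> \<longleftrightarrow>
     (\<forall>x \<in> int_adjoin (1 / \<beta>) \<inter> {0..<1}. finite {n. n \<ge> 1 \<and> beta_expansion \<beta> x n \<noteq> 0})"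


section \<open>Algebraic numbers and number fields\<close>

text \<open>The minimal polynomial over \<open>\<rat>\<close>; only meaningful if \<open>x\<close> is algebraic.\<close>

definition min_rat_poly :: "'a :: field_char_0 \<Rightarrow> rat poly" where
  "min_rat_poly x =
     (THE p. lead_coeff p = 1 \<and> irreducible p \<and> poly (map_poly of_rat p) x = 0)"

definition galois_conjugates :: "real \<Rightarrow> complex set" where
  "galois_conjugates x = {z. poly (map_poly of_rat (min_rat_poly x)) z = 0}"

definition is_subfield :: "'a :: field set \<Rightarrow> bool" where
  "is_subfield K \<longleftrightarrow> 0 \<in> K \<and> 1 \<in> K \<and>
     (\<forall>x\<in>K. \<forall>y\<in>K. x + y \<in> K \<and> x * y \<in> K) \<and>
     (\<forall>x\<in>K. - x \<in> K \<and> inverse x \<in> K)"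

text \<open>The field \<open>\<rat>(x)\<close>, as the smallest subfield of the reals containing \<open>x\<close>.\<close>

definition rat_adjoin :: "real \<Rightarrow> real set" where
  "rat_adjoin x = is_subfield hull {x}"

definition ring_of_integers :: "real set \<Rightarrow> real set" where
  "ring_of_integers K = {x \<in> K. algebraic_int x}"

definition field_embedding :: "real set \<Rightarrow> (real \<Rightarrow> complex) \<Rightarrow> bool" where
  "field_embedding K \<sigma> \<longleftrightarrow> \<sigma> 1 = 1 \<and>
     (\<forall>x\<in>K. \<forall>y\<in>K. \<sigma> (x + y) = \<sigma> x + \<sigma> y \<and> \<sigma> (x * y) = \<sigma> x * \<sigma> y)"

definition totally_real :: "real set \<Rightarrow> bool" where
  "totally_real K \<longleftrightarrow> (\<forall>\<sigma>. field_embedding K \<sigma> \<longrightarrow> \<sigma> ` K \<subseteq> \<real>)"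

definition pisot_number :: "real \<Rightarrow> bool" where
  "pisot_number \<beta> \<longleftrightarrow> algebraic_int \<beta> \<and> \<beta> > 1 \<and>
     (\<forall>z \<in> galois_conjugates \<beta> - {of_real \<beta>}. cmod z < 1)"

definition pisot_unit :: "real \<Rightarrow> bool" where
  "pisot_unit \<beta> \<longleftrightarrow> pisot_number \<beta> \<and>
     (\<exists>y \<in> ring_of_integers (rat_adjoin \<beta>). \<beta> * y = 1)"

end

(*
  Let alpha be a non-real conjugate of beta and sigma the embedding of Q(beta) with
  sigma beta = alpha.  Reading beta-expansions backwards attaches to each x in (0,1] a compact
  tile in the complex plane, namely the closure of the points alpha^k sigma(y) where the k-th
  iterate of y is x.  The tile of x is the union of alpha * (tile of y) over the preimages y
  of x, and a rational x in (0,1) has a purely periodic expansion iff 0 lies in its tile.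
  Only finitely many x with a given denominator have 0 in their tile, and the map permutes
  them, so close to 0 such a tile is invariant under multiplication by some power alpha^p.

  Up to translation by sigma x the tile of x is locally constant to the left of any x, and
  around any rational x < 1.  If gamma = gamma(beta) were rational, periodicity below gamma would
  put a real segment starting at 0 into the tile of gamma.  As no power of alpha is real,
  the invariance spreads this segment densely around 0, so 0 is interior to the tile.  For
  gamma < 1 all rationals slightly above gamma would then be purely periodic as well.  For
  gamma = 1 and for gamma = 0 the contradiction comes from property (F): non-negative elements of
  Z[beta] with small conjugate have no fractional part.
*)
theory Submission
  imports Defs "HOL-Analysis.Kronecker_Approximation_Theorem"
begin

text \<open>A tile, taken relative to its base point, jumps only at the finitely many elements of
  Z[\<beta>] that lie in the unit interval and have a bounded conjugate. A rational strictly between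
  0 and 1 is never in Z[\<beta>], hence never a jump; this is what lets periodicity cross a rational
  gamma < 1. The point 1 is in Z[\<beta>] and has no tile to its right, which is why gamma = 1 needs
  an argument of its own. All finiteness comes from one fact: in degree 3 with a complex pair of
  conjugates, bounds on x and \<sigma> x leave only finitely many x in Z[\<beta>]. That \<beta> is a
  unit enters when passing to preimages, since division by \<beta> then keeps the denominator. The
  degree also settles the angle of \<alpha>: a real power of \<alpha> would either equal the same
  power of \<beta> or give \<alpha> a quadratic equation over the rationals.\<close>

lemma closure_UN_finite:
  assumes "finite I"
  shows "closure (\<Union>i\<in>I. A i) = (\<Union>i\<in>I. closure (A i))"
  using assms by induction auto

section \<open>The backward tree of the beta-transformation\<close>

text \<open>The beta-transformation with representatives modulo 1 taken in \<open>(0,1]\<close>. On orbits that avoid the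
  integers both maps agree, and the point \<open>1\<close>, a possible value of \<open>gamma_beta\<close>, becomes an
  ordinary point.\<close>

definition left_map :: "real \<Rightarrow> real \<Rightarrow> real" where
  "left_map \<beta> y = \<beta> * y - of_int (\<lceil>\<beta> * y\<rceil> - 1)"

text \<open>The differences \<open>\<beta>\<^sup>k y - x\<close> over all \<open>y\<close> whose \<open>k\<close>-th iterate is \<open>x\<close> (see \<open>int_parts_iff\<close>).
  This form makes the dependence on \<open>x\<close> explicit.\<close>

primrec int_parts :: "real \<Rightarrow> nat \<Rightarrow> real \<Rightarrow> real set" where
  "int_parts \<beta> 0 x = {0}"
| "int_parts \<beta> (Suc k) x = {\<beta> * N + of_int a | N a.
     (x + of_int a) / \<beta> \<in> {0<..1} \<and> N \<in> int_parts \<beta> k ((x + of_int a) / \<beta>)}"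

lemma left_map_range: "left_map \<beta> y \<in> {0<..1}"
  unfolding left_map_def by (simp; linarith)

lemma left_map_pow_range:
  assumes "y \<in> {0<..1}"
  shows "(left_map \<beta> ^^ n) y \<in> {0<..1}"
  using assms left_map_range by (cases n) auto

lemma left_map_eqI:
  assumes "x \<in> {0<..1}" "\<beta> * y = x + of_int a"
  shows "left_map \<beta> y = x"
proof -
  have "\<lceil>x\<rceil> = 1"
    using assms(1) by (simp add: ceiling_eq_iff)
  thus ?thesis
    by (simp add: left_map_def assms(2))
qed

lemma left_map_iff:
  assumes "x \<in> {0<..1}" "\<beta> > 0"
  shows "left_map \<beta> u = x \<longleftrightarrow> (\<exists>a::int. u = (x + of_int a) / \<beta>)"
proof
  assume "left_map \<beta> u = x"
  hence "u = (x + of_int (\<lceil>\<beta> * u\<rceil> - 1)) / \<beta>"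
    using assms(2) by (simp add: left_map_def field_simps)
  thus "\<exists>a::int. u = (x + of_int a) / \<beta>" by blast
next
  assume "\<exists>a::int. u = (x + of_int a) / \<beta>"
  then obtain a :: int where "u = (x + of_int a) / \<beta>" by blast
  hence "\<beta> * u = x + of_int a" using assms(2) by simp
  thus "left_map \<beta> u = x" by (rule left_map_eqI[OF assms(1)])
qed

text \<open>The last step of the orbit is peeled off: with \<open>u\<close> the preimage of
  \<open>x\<close> on the orbit of \<open>y\<close>, the relation \<open>\<beta> * u = x + a\<close>
  turns the difference for \<open>u\<close> into the one for \<open>x\<close>.\<close>

lemma int_parts_iff:
  assumes "x \<in> {0<..1}" "\<beta> > 0"
  shows "N \<in> int_parts \<beta> k x \<longleftrightarrow>
           (\<exists>y\<in>{0<..1}. (left_map \<beta> ^^ k) y = x \<and> N = \<beta> ^ k * y - x)"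
  using assms(1)
proof (induction k arbitrary: x N)
  case 0
  thus ?case by auto
next
  case (Suc k)
  show ?case
  proof
    assume "N \<in> int_parts \<beta> (Suc k) x"
    then obtain N1 and a :: int where *: "N = \<beta> * N1 + of_int a"
      "(x + of_int a) / \<beta> \<in> {0<..1}" "N1 \<in> int_parts \<beta> k ((x + of_int a) / \<beta>)"
      by auto
    then obtain y where y: "y \<in> {0<..1}" "(left_map \<beta> ^^ k) y = (x + of_int a) / \<beta>"
      "N1 = \<beta> ^ k * y - (x + of_int a) / \<beta>"
      using Suc.IH by blast
    have "left_map \<beta> ((x + of_int a) / \<beta>) = x"
      using left_map_iff[OF Suc.prems assms(2)] by blast
    hence "(left_map \<beta> ^^ Suc k) y = x" using y by simp
    moreover have "N = \<beta> ^ Suc k * y - x"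
    proof -
      have "\<beta> * ((x + of_int a) / \<beta>) = x + of_int a" using assms(2) by simp
      thus ?thesis unfolding *(1) y(3) by (simp add: algebra_simps)
    qed
    ultimately show "\<exists>y\<in>{0<..1}. (left_map \<beta> ^^ Suc k) y = x \<and> N = \<beta> ^ Suc k * y - x"
      using y(1) by blast
  next
    assume "\<exists>y\<in>{0<..1}. (left_map \<beta> ^^ Suc k) y = x \<and> N = \<beta> ^ Suc k * y - x"
    then obtain y where y: "y \<in> {0<..1}" "(left_map \<beta> ^^ Suc k) y = x" "N = \<beta> ^ Suc k * y - x"
      by blast
    define u where "u = (left_map \<beta> ^^ k) y"
    have u: "u \<in> {0<..1}" unfolding u_def by (rule left_map_pow_range[OF y(1)])
    have "left_map \<beta> u = x" using y(2) by (simp add: u_def)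
    then obtain a :: int where a: "u = (x + of_int a) / \<beta>"
      using left_map_iff[OF Suc.prems assms(2)] by blast
    have "\<beta> ^ k * y - u \<in> int_parts \<beta> k u"
      using Suc.IH[OF u] y(1) u_def by blast
    moreover have "N = \<beta> * (\<beta> ^ k * y - u) + of_int a"
    proof -
      have "\<beta> * u = x + of_int a" using a assms(2) by simp
      thus ?thesis unfolding y(3) by (simp add: algebra_simps)
    qed
    ultimately show "N \<in> int_parts \<beta> (Suc k) x"
      using u a by auto
  qed
qed

lemma int_parts_nonneg:
  assumes "x \<in> {0<..1}" "\<beta> > 0" "N \<in> int_parts \<beta> k x"
  shows "N \<ge> 0"
  using assms
proof (induction k arbitrary: x N)
  case 0
  thus ?case by simp
next
  case (Suc k)
  then obtain N1 and a :: int where *: "N = \<beta> * N1 + of_int a"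
    "(x + of_int a) / \<beta> \<in> {0<..1}" "N1 \<in> int_parts \<beta> k ((x + of_int a) / \<beta>)"
    by auto
  have "x + of_int a > 0" using *(2) Suc.prems(2) by (simp add: zero_less_divide_iff)
  hence "a \<ge> 0" using Suc.prems(1) by (simp; linarith)
  moreover have "N1 \<ge> 0" using Suc.IH *(2,3) Suc.prems(2) by blast
  ultimately show ?case using * Suc.prems(2) by simp
qed

text \<open>A leading zero digit can always be added: with y also y / \<beta> lies in (0,1], and it
  is mapped to y.\<close>

lemma int_parts_mono_Suc:
  assumes "x \<in> {0<..1}" "\<beta> \<ge> 1" "N \<in> int_parts \<beta> k x"
  shows "N \<in> int_parts \<beta> (Suc k) x"
  using assms
proof (induction k arbitrary: x N)
  case 0
  thus ?case by (auto intro!: exI[of _ 0])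
next
  case (Suc k)
  then obtain N1 and a :: int where *: "N = \<beta> * N1 + of_int a"
    "(x + of_int a) / \<beta> \<in> {0<..1}" "N1 \<in> int_parts \<beta> k ((x + of_int a) / \<beta>)"
    by auto
  have "N1 \<in> int_parts \<beta> (Suc k) ((x + of_int a) / \<beta>)"
    using Suc.IH[OF *(2) _ *(3)] Suc.prems(2) by blast
  thus ?case using *(1,2) by (subst int_parts.simps(2)) blast
qed

lemma int_parts_mono:
  assumes "x \<in> {0<..1}" "\<beta> \<ge> 1" "N \<in> int_parts \<beta> k x" "k \<le> l"
  shows "N \<in> int_parts \<beta> l x"
  using assms(4,3) by (induction rule: dec_induct) (use int_parts_mono_Suc assms in blast)+

section \<open>Complex embeddings of subfields of the reals\<close>

locale subfield_embedding =
  fixes K :: "real set" and \<sigma> :: "real \<Rightarrow> complex"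
  assumes subfield: "is_subfield K"
    and embedding: "field_embedding K \<sigma>"
begin

lemma K_0 [simp]: "0 \<in> K" and K_1 [simp]: "1 \<in> K"
  and K_add [intro]: "x \<in> K \<Longrightarrow> y \<in> K \<Longrightarrow> x + y \<in> K"
  and K_mult [intro]: "x \<in> K \<Longrightarrow> y \<in> K \<Longrightarrow> x * y \<in> K"
  and K_uminus [intro]: "x \<in> K \<Longrightarrow> - x \<in> K"
  and K_inverse [intro]: "x \<in> K \<Longrightarrow> inverse x \<in> K"
  using subfield by (auto simp: is_subfield_def)

lemma K_diff [intro]: "x \<in> K \<Longrightarrow> y \<in> K \<Longrightarrow> x - y \<in> K"
  using K_add[of x "- y"] by auto

lemma K_divide [intro]: "x \<in> K \<Longrightarrow> y \<in> K \<Longrightarrow> x / y \<in> K"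
  by (simp add: divide_inverse K_inverse K_mult)

lemma K_of_nat [simp]: "of_nat n \<in> K"
  by (induction n) auto

lemma K_of_int [simp]: "of_int a \<in> K"
  by (cases a rule: int_cases2) auto

lemma K_Rats: "x \<in> \<rat> \<Longrightarrow> x \<in> K"
  by (elim Rats_cases') auto

lemma K_power [intro]: "x \<in> K \<Longrightarrow> x ^ n \<in> K"
  by (induction n) auto

lemma sigma_1 [simp]: "\<sigma> 1 = 1"
  and sigma_add: "x \<in> K \<Longrightarrow> y \<in> K \<Longrightarrow> \<sigma> (x + y) = \<sigma> x + \<sigma> y"
  and sigma_mult: "x \<in> K \<Longrightarrow> y \<in> K \<Longrightarrow> \<sigma> (x * y) = \<sigma> x * \<sigma> y"
  using embedding by (auto simp: field_embedding_def)

lemma sigma_0 [simp]: "\<sigma> 0 = 0"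
  using sigma_add[of 0 0] by simp

lemma sigma_uminus: "x \<in> K \<Longrightarrow> \<sigma> (- x) = - \<sigma> x"
  using sigma_add[of x "- x"] by (auto simp: add_eq_0_iff K_uminus)

lemma sigma_diff: "x \<in> K \<Longrightarrow> y \<in> K \<Longrightarrow> \<sigma> (x - y) = \<sigma> x - \<sigma> y"
  using sigma_add[of x "- y"] sigma_uminus[of y] by (auto simp: K_uminus)

lemma sigma_of_nat [simp]: "\<sigma> (of_nat n) = of_nat n"
  by (induction n) (auto simp: sigma_add)

lemma sigma_of_int [simp]: "\<sigma> (of_int a) = of_int a"
  by (cases a rule: int_cases2) (auto simp: sigma_uminus)

lemma sigma_divide:
  assumes "x \<in> K" "y \<in> K" "y \<noteq> 0"
  shows "\<sigma> (x / y) = \<sigma> x / \<sigma> y"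
proof -
  have "\<sigma> (x / y) * \<sigma> y = \<sigma> x"
    using sigma_mult[OF K_divide[OF assms(1,2)] assms(2)] assms(3) by simp
  moreover have "\<sigma> (inverse y) * \<sigma> y = 1"
    using sigma_mult[OF K_inverse[OF assms(2)] assms(2)] assms(3) by simp
  hence "\<sigma> y \<noteq> 0" by auto
  ultimately show ?thesis by (simp add: field_simps)
qed

lemma sigma_power: "x \<in> K \<Longrightarrow> \<sigma> (x ^ n) = \<sigma> x ^ n"
  by (induction n) (auto simp: sigma_mult K_power)

lemma sigma_Rats:
  assumes "x \<in> \<rat>"
  shows "\<sigma> x = of_real x"
  using assms by (elim Rats_cases') (simp add: sigma_divide)

end

section \<open>Tiles\<close>

text \<open>Separates the dynamics from the arithmetic. \<open>R\<close> stands for Z[\<beta>],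
  which contains 1 / \<beta> as \<beta> is a unit; \<open>R_discrete\<close> expresses that it is a
  lattice in the product of the real line and the complex plane, and \<open>finite_expansion\<close>
  is property (F).\<close>

locale beta_embedding = subfield_embedding +
  fixes \<beta> :: real and R :: "real set"
  assumes beta_gt_1: "\<beta> > 1"
    and R_subset: "R \<subseteq> K"
    and one_in_R: "1 \<in> R"
    and R_add: "\<And>x y. x \<in> R \<Longrightarrow> y \<in> R \<Longrightarrow> x + y \<in> R"
    and R_mult: "\<And>x y. x \<in> R \<Longrightarrow> y \<in> R \<Longrightarrow> x * y \<in> R"
    and R_uminus: "\<And>x. x \<in> R \<Longrightarrow> - x \<in> R"
    and beta_in_R: "\<beta> \<in> R"
    and inverse_beta_in_R: "1 / \<beta> \<in> R"
    and R_discrete: "\<And>A B. finite {x \<in> R. \<bar>x\<bar> \<le> A \<and> cmod (\<sigma> x) \<le> B}"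
    and R_rat: "\<And>r. r \<in> \<rat> \<Longrightarrow> r \<in> R \<Longrightarrow> 0 < r \<Longrightarrow> 1 \<le> r"
    and sigma_beta_less_1: "cmod (\<sigma> \<beta>) < 1"
    and sigma_beta_power_nonreal: "\<And>n. n > 0 \<Longrightarrow> \<sigma> \<beta> ^ n \<notin> \<real>"
    and finite_expansion:
      "\<And>x. x \<in> R \<Longrightarrow> 0 \<le> x \<Longrightarrow> x < 1 \<Longrightarrow> \<exists>n. (beta_transformation \<beta> ^^ n) x = 0"
begin

definition \<alpha> :: complex where "\<alpha> = \<sigma> \<beta>"

lemma beta_pos [simp]: "\<beta> > 0" and beta_nonneg [simp]: "\<beta> \<ge> 0"
  and beta_nonzero [simp]: "\<beta> \<noteq> 0"
  using beta_gt_1 by auto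

lemma K_beta [simp]: "\<beta> \<in> K"
  using beta_in_R R_subset by blast

lemma R_0 [simp]: "0 \<in> R"
  using R_add[OF one_in_R R_uminus[OF one_in_R]] by simp

lemma R_1 [simp]: "1 \<in> R" by (rule one_in_R)

lemma R_diff: "x \<in> R \<Longrightarrow> y \<in> R \<Longrightarrow> x - y \<in> R"
  using R_add[OF _ R_uminus, of x y] by simp

lemma R_of_nat [simp]: "of_nat n \<in> R"
  by (induction n) (auto intro: R_add)

lemma R_of_int [simp]: "of_int a \<in> R"
  by (cases a rule: int_cases2) (auto intro: R_uminus)

lemma R_divide_beta: "x \<in> R \<Longrightarrow> x / \<beta> \<in> R"
  using R_mult[OF _ inverse_beta_in_R] by simp

lemma R_beta_power: "\<beta> ^ n \<in> R"
  by (induction n) (auto intro: R_mult beta_in_R)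

lemma R_divide_beta_power: "x \<in> R \<Longrightarrow> x / \<beta> ^ n \<in> R"
proof (induction n)
  case (Suc n)
  have eq: "x / \<beta> ^ Suc n = x / \<beta> ^ n / \<beta>" by (simp add: mult.commute)
  show ?case unfolding eq by (rule R_divide_beta[OF Suc.IH[OF Suc.prems]])
qed simp

lemma R_in_K [intro]: "x \<in> R \<Longrightarrow> x \<in> K"
  using R_subset by blast

lemma alpha_nonzero [simp]: "\<alpha> \<noteq> 0"
  using sigma_beta_power_nonreal[of 1] by (auto simp: \<alpha>_def)

lemma alpha_less_1: "cmod \<alpha> < 1"
  using sigma_beta_less_1 by (simp add: \<alpha>_def)

lemma sigma_beta [simp]: "\<sigma> \<beta> = \<alpha>" by (simp add: \<alpha>_def)

lemma sigma_beta_mult [simp]: "x \<in> K \<Longrightarrow> \<sigma> (\<beta> * x) = \<alpha> * \<sigma> x"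
  by (simp add: sigma_mult)

lemma beta_not_int: "\<beta> \<noteq> of_int a"
proof
  assume "\<beta> = of_int a"
  hence "\<sigma> \<beta> = of_int a" using sigma_of_int[of a] by metis
  thus False using sigma_beta_power_nonreal[of 1] by simp
qed

lemma sigma_affine: "x \<in> K \<Longrightarrow> \<sigma> (\<beta> * x + of_int a) = \<alpha> * \<sigma> x + of_int a"
  by (simp add: sigma_add K_mult)

abbreviation B :: "nat \<Rightarrow> real \<Rightarrow> real set" where "B \<equiv> int_parts \<beta>"
abbreviation T :: "real \<Rightarrow> real" where "T \<equiv> left_map \<beta>"

lemma B_in_R: "N \<in> B k x \<Longrightarrow> N \<in> R"
  by (induction k arbitrary: x N) (auto intro!: R_add R_mult beta_in_R)

text \<open>\<open>C\<close> is chosen such that \<open>z \<mapsto> \<alpha> z + a\<close> maps the disc of radius \<open>C\<close> into itself for every digit \<open>a\<close>.\<close>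

definition C :: real where "C = (\<beta> + 1) / (1 - cmod \<alpha>)"

lemma C_eq: "cmod \<alpha> * C + (\<beta> + 1) = C"
  using alpha_less_1 by (simp add: C_def field_simps)

lemma C_ge: "\<beta> + 1 \<le> C"
  using C_eq alpha_less_1 beta_gt_1 unfolding C_def
  by (simp add: field_simps)

lemma C_step:
  assumes "cmod z \<le> C" "\<bar>of_int a :: real\<bar> \<le> \<beta> + 1"
  shows "cmod (\<alpha> * z + of_int a) \<le> C"
proof -
  have "cmod (\<alpha> * z + of_int a) \<le> cmod \<alpha> * cmod z + \<bar>of_int a\<bar>"
    by (metis norm_mult norm_of_int norm_triangle_ineq)
  also have "\<dots> \<le> cmod \<alpha> * C + (\<beta> + 1)"
    using assms by (intro add_mono mult_left_mono) auto
  finally show ?thesis using C_eq by simp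
qed

lemma digit_bound:
  assumes "x \<in> {0<..1}" "(x + of_int a) / \<beta> \<in> {0<..1}"
  shows "0 \<le> a" "\<bar>of_int a :: real\<bar> \<le> \<beta>"
proof -
  have "0 < x + of_int a" "x + of_int a \<le> \<beta>"
    using assms(2) beta_gt_1 by (auto simp: zero_less_divide_iff divide_le_eq)
  moreover from this assms(1) show "0 \<le> a" by (simp; linarith)
  ultimately show "\<bar>of_int a :: real\<bar> \<le> \<beta>" using assms(1) by simp
qed

lemma B_bound: "x \<in> {0<..1} \<Longrightarrow> N \<in> B k x \<Longrightarrow> cmod (\<sigma> N) \<le> C"
proof (induction k arbitrary: x N)
  case 0
  thus ?case using C_ge beta_gt_1 by simp
next
  case (Suc k)
  then obtain N1 and a :: int where *: "N = \<beta> * N1 + of_int a"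
    "(x + of_int a) / \<beta> \<in> {0<..1}" "N1 \<in> B k ((x + of_int a) / \<beta>)"
    by auto
  have "cmod (\<alpha> * \<sigma> N1 + of_int a) \<le> C"
    using Suc.IH[OF *(2,3)] digit_bound[OF Suc.prems(1) *(2)] by (intro C_step) auto
  moreover have "\<sigma> N = \<alpha> * \<sigma> N1 + of_int a"
    unfolding *(1) using B_in_R[OF *(3)] by (intro sigma_affine) auto
  ultimately show ?case by simp
qed

definition S :: "real \<Rightarrow> complex set" where "S x = (\<Union>k. \<sigma> ` B k x)"
definition G :: "real \<Rightarrow> complex set" where "G x = closure (S x)"
definition tile :: "real \<Rightarrow> complex set" where "tile x = {z. z - \<sigma> x \<in> G x}"

lemma closed_tile: "closed (tile x)"
proof -
  have "tile x = (\<lambda>z. z - \<sigma> x) -` G x" by (auto simp: tile_def)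
  thus ?thesis by (auto simp: G_def intro!: closed_vimage continuous_intros)
qed

lemma G_bound: "x \<in> {0<..1} \<Longrightarrow> z \<in> G x \<Longrightarrow> cmod z \<le> C"
proof -
  assume x: "x \<in> {0<..1}" and z: "z \<in> G x"
  have "S x \<subseteq> cball 0 C" using B_bound[OF x] by (auto simp: S_def)
  hence "closure (S x) \<subseteq> cball 0 C" by (rule closure_minimal) auto
  thus ?thesis using z by (auto simp: G_def)
qed

definition digits :: "real \<Rightarrow> int set" where
  "digits x = {a. (x + of_int a) / \<beta> \<in> {0<..1}}"

lemma finite_digits: "finite (digits x)"
proof -
  have "digits x \<subseteq> {\<lfloor>- x\<rfloor>..\<lceil>\<beta> - x\<rceil>}"
    using beta_pos unfolding digits_def
    by (auto simp: zero_less_divide_iff divide_le_eq floor_le_iff le_ceiling_iff simp del: beta_pos)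
  thus ?thesis using finite_subset by blast
qed

lemma S_rec:
  assumes "x \<in> {0<..1}"
  shows "S x = (\<Union>a\<in>digits x. (\<lambda>z. of_int a + z) ` (\<lambda>z. \<alpha> * z) ` S ((x + of_int a) / \<beta>))"
    (is "_ = ?rhs")
proof (intro equalityI subsetI)
  fix z assume "z \<in> S x"
  then obtain k N where kN: "N \<in> B k x" "z = \<sigma> N" by (auto simp: S_def)
  \<comment> \<open>Raising the level also covers \<open>k = 0\<close>, where there is no last digit
    to split off.\<close>
  hence "N \<in> B (Suc k) x"
    using int_parts_mono_Suc[OF assms _ kN(1)] beta_gt_1 by simp
  then obtain N1 and a :: int where *: "N = \<beta> * N1 + of_int a"
    "(x + of_int a) / \<beta> \<in> {0<..1}" "N1 \<in> B k ((x + of_int a) / \<beta>)"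
    by auto
  have "z = of_int a + \<alpha> * \<sigma> N1"
    unfolding kN(2) *(1) using B_in_R[OF *(3)] by (subst sigma_affine) auto
  moreover have "a \<in> digits x" "\<sigma> N1 \<in> S ((x + of_int a) / \<beta>)"
    using * by (auto simp: S_def digits_def)
  ultimately show "z \<in> ?rhs" by blast
next
  fix z assume "z \<in> ?rhs"
  then obtain a k N where *: "a \<in> digits x" "N \<in> B k ((x + of_int a) / \<beta>)"
    "z = of_int a + \<alpha> * \<sigma> N"
    by (auto simp: S_def)
  have "\<beta> * N + of_int a \<in> B (Suc k) x"
    using * by (auto simp: digits_def)
  moreover have "\<sigma> (\<beta> * N + of_int a) = z"
    using *(3) B_in_R[OF *(2)] by (subst sigma_affine) auto
  ultimately show "z \<in> S x" unfolding S_def by blast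
qed

text \<open>Only finitely many digits occur, so the closure can be moved inside the union in
  \<open>S_rec\<close>.\<close>

lemma G_rec:
  assumes "x \<in> {0<..1}"
  shows "G x = (\<Union>a\<in>digits x. (\<lambda>z. of_int a + z) ` (\<lambda>z. \<alpha> * z) ` G ((x + of_int a) / \<beta>))"
proof -
  have lin: "linear (\<lambda>z. \<alpha> * z)" by (auto intro: linearI simp: algebra_simps scaleR_conv_of_real)
  have inj: "inj (\<lambda>z. \<alpha> * z)" by (auto intro: injI)
  show ?thesis
    unfolding G_def S_rec[OF assms] closure_injective_linear_image[OF lin inj]
      closure_translation[symmetric]
    by (rule closure_UN_finite[OF finite_digits])
qed

text \<open>The digit drops out in tile coordinates: it cancels against the translation by \<sigma>
  ((x + a) / \<beta>) = (\<sigma> x + a) / \<alpha>.\<close>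

lemma tile_rec:
  assumes "x \<in> {0<..1}" "x \<in> K"
  shows "z \<in> tile x \<longleftrightarrow> (\<exists>y\<in>{0<..1}. T y = x \<and> z / \<alpha> \<in> tile y)"
proof -
  have eq: "z - \<sigma> x = of_int a + \<alpha> * w \<longleftrightarrow> w = z / \<alpha> - \<sigma> ((x + of_int a) / \<beta>)" for a w
  proof -
    have "\<sigma> ((x + of_int a) / \<beta>) = (\<sigma> x + of_int a) / \<alpha>"
      using assms(2) by (subst sigma_divide) (auto simp: sigma_add)
    thus ?thesis by (auto simp: field_simps)
  qed
  have "z \<in> tile x \<longleftrightarrow> (\<exists>a\<in>digits x. \<exists>w\<in>G ((x + of_int a) / \<beta>). z - \<sigma> x = of_int a + \<alpha> * w)"
    unfolding tile_def G_rec[OF assms(1)] by auto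
  also have "\<dots> \<longleftrightarrow> (\<exists>a\<in>digits x. z / \<alpha> \<in> tile ((x + of_int a) / \<beta>))"
    unfolding eq by (auto simp: tile_def)
  also have "\<dots> \<longleftrightarrow> (\<exists>y\<in>{0<..1}. T y = x \<and> z / \<alpha> \<in> tile y)"
    using left_map_iff[OF assms(1) beta_pos] by (auto simp: digits_def)
  finally show ?thesis .
qed

end

section \<open>Local self-similarity at the origin\<close>

text \<open>As no power of \<open>a\<close> is real, its angle is an irrational multiple of a full
  turn, and Kronecker's theorem makes the angles of \<open>a ^ n * z\<close> dense. The error is
  measured relative to the modulus so that it survives division by \<open>a ^ n\<close>.\<close>

lemma powers_approach_positive_axis:
  fixes a z :: complex
  assumes nonreal: "\<And>n. n > 0 \<Longrightarrow> a ^ n \<notin> \<real>" and "e > 0"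
  shows "\<exists>n. cmod (a ^ n * z - of_real (cmod (a ^ n * z))) \<le> e * cmod (a ^ n * z)"
proof -
  define \<theta> \<phi> where "\<theta> = Arg a / (2 * pi)" and "\<phi> = Arg z / (2 * pi)"
  have a: "a = rcis (cmod a) (2 * pi * \<theta>)" and z: "z = rcis (cmod z) (2 * pi * \<phi>)"
    by (simp_all add: \<theta>_def \<phi>_def rcis_cmod_Arg)
  have "\<theta> \<notin> \<rat>"
  proof
    assume "\<theta> \<in> \<rat>"
    then obtain i j :: int where ij: "j > 0" "\<theta> = of_int i / of_int j"
      by (rule Rats_cases') auto
    have "a ^ nat j = rcis (cmod a ^ nat j) (2 * pi * of_int i)"
      using ij by (subst a) (simp add: DeMoivre2)
    also have "\<dots> = of_real (cmod a ^ nat j)"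
      by (simp add: rcis_def cis_multiple_2pi)
    finally show False using nonreal[of "nat j"] ij by simp
  qed
  moreover have "0 \<le> frac (- \<phi>)" "frac (- \<phi>) \<le> 1"
    by (simp_all add: less_imp_le[OF frac_lt_1])
  moreover have "e / (2 * pi) > 0" using assms by simp
  \<comment> \<open>The target is - \<phi>, so that the total angle k \<theta> + \<phi> comes close
    to an integer number of turns.\<close>
  ultimately obtain k where k: "\<bar>frac (real k * \<theta>) - frac (- \<phi>)\<bar> < e / (2 * pi)"
    using Kronecker_approx_1_explicit by metis
  define d where "d = frac (real k * \<theta>) - frac (- \<phi>)"
  have "real k * \<theta> + \<phi> = d + of_int (\<lfloor>real k * \<theta>\<rfloor> - \<lfloor>- \<phi>\<rfloor>)"
    by (simp add: d_def frac_def)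
  hence "2 * pi * (real k * \<theta> + \<phi>) = 2 * pi * d + 2 * pi * of_int (\<lfloor>real k * \<theta>\<rfloor> - \<lfloor>- \<phi>\<rfloor>)"
    by (metis distrib_left)
  hence "cis (2 * pi * (real k * \<theta> + \<phi>)) = cis (2 * pi * d)"
    by (simp only: cis_mult[symmetric] cis_multiple_2pi Ints_of_int mult_1_right)
  moreover have "a ^ k * z = rcis (cmod a ^ k) (real k * (2 * pi * \<theta>)) * rcis (cmod z) (2 * pi * \<phi>)"
    using a z by (metis DeMoivre2)
  hence "a ^ k * z = rcis (cmod (a ^ k * z)) (2 * pi * (real k * \<theta> + \<phi>))"
    by (simp add: rcis_mult norm_mult norm_power algebra_simps)
  ultimately have eq: "a ^ k * z = of_real (cmod (a ^ k * z)) * cis (2 * pi * d)"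
    by (simp add: rcis_def)
  have "cmod (cis (2 * pi * d) - 1) = 2 * \<bar>sin (2 * pi * d / 2)\<bar>"
    unfolding cis_conv_exp by (rule dist_exp_i_1)
  also have "\<dots> \<le> 2 * \<bar>2 * pi * d / 2\<bar>"
    by (intro mult_left_mono abs_sin_x_le_abs_x) auto
  also have "\<dots> = 2 * pi * \<bar>d\<bar>" by (simp add: abs_mult)
  also have "\<dots> \<le> e" using k by (simp add: d_def field_simps)
  finally have le: "cmod (cis (2 * pi * d) - 1) \<le> e" .
  have "a ^ k * z - of_real (cmod (a ^ k * z)) = of_real (cmod (a ^ k * z)) * (cis (2 * pi * d) - 1)"
    by (subst eq) (simp add: algebra_simps)
  hence "cmod (a ^ k * z - of_real (cmod (a ^ k * z))) = cmod (a ^ k * z) * cmod (cis (2 * pi * d) - 1)"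
    by (simp add: norm_mult)
  also have "\<dots> \<le> cmod (a ^ k * z) * e"
    by (intro mult_left_mono le) auto
  finally show ?thesis by (auto simp: mult.commute)
qed

context beta_embedding
begin

text \<open>The denominator \<open>m\<close> is relative to \<open>R\<close>: the preimages of a
  rational point need not be rational, but they must stay in the set.\<close>

definition P :: "nat \<Rightarrow> real set" where
  "P m = {x \<in> {0<..1}. of_nat m * x \<in> R \<and> 0 \<in> tile x}"

lemma P_in_K:
  assumes "m > 0" "of_nat m * x \<in> R"
  shows "x \<in> K"
proof -
  have "(of_nat m * x) / of_nat m \<in> K" using assms by (intro K_divide) auto
  thus ?thesis using assms by simp
qed

text \<open>If 0 lies in the tile of \<open>x\<close>, then \<sigma> x is bounded by
  \<open>C\<close>, and discreteness of \<open>R\<close> applies to \<open>m * x\<close>.\<close>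

lemma finite_P:
  assumes "m > 0"
  shows "finite (P m)"
proof (rule finite_subset)
  show "P m \<subseteq> (\<lambda>y. y / of_nat m) ` {y \<in> R. \<bar>y\<bar> \<le> of_nat m \<and> cmod (\<sigma> y) \<le> of_nat m * C}"
  proof
    fix x assume x: "x \<in> P m"
    hence "x \<in> K" using P_in_K assms by (auto simp: P_def)
    have "- \<sigma> x \<in> G x" using x by (auto simp: P_def tile_def)
    hence "cmod (\<sigma> x) \<le> C" using G_bound[of x "- \<sigma> x"] x by (auto simp: P_def)
    moreover have "\<sigma> (of_nat m * x) = of_nat m * \<sigma> x"
      using \<open>x \<in> K\<close> by (simp add: sigma_mult)
    ultimately have "cmod (\<sigma> (of_nat m * x)) \<le> of_nat m * C"
      by (simp add: norm_mult mult_left_mono)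
    moreover have "\<bar>of_nat m * x\<bar> \<le> of_nat m" using x by (auto simp: P_def abs_mult mult_left_le)
    ultimately show "x \<in> (\<lambda>y. y / of_nat m) ` {y \<in> R. \<bar>y\<bar> \<le> of_nat m \<and> cmod (\<sigma> y) \<le> of_nat m * C}"
      using x assms by (intro image_eqI[where x = "of_nat m * x"]) (auto simp: P_def)
  qed
qed (use R_discrete in blast)

text \<open>Here 1 / \<beta> in \<open>R\<close> is essential: taking preimages does not enlarge the
  denominator.\<close>

lemma T_preimage_in_R:
  assumes "T y = x" "x \<in> {0<..1}" "of_nat m * x \<in> R"
  shows "of_nat m * y \<in> R"
proof -
  obtain a :: int where a: "y = (x + of_int a) / \<beta>"
    using left_map_iff[OF assms(2) beta_pos] assms(1) by blast
  have "(of_nat m * x + of_int (int m * a)) / \<beta> \<in> R"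
    by (intro R_divide_beta R_add assms R_of_int)
  moreover have "of_nat m * y = (of_nat m * x + of_int (int m * a)) / \<beta>"
    by (simp add: a field_simps)
  ultimately show ?thesis by simp
qed

lemma P_surj:
  assumes "m > 0" "x \<in> P m"
  obtains y where "y \<in> P m" "T y = x"
proof -
  have x: "x \<in> {0<..1}" "of_nat m * x \<in> R" "0 \<in> tile x" "x \<in> K"
    using assms P_in_K by (auto simp: P_def)
  then obtain y where y: "y \<in> {0<..1}" "T y = x" "0 \<in> tile y"
    using tile_rec[OF x(1,4), of 0] by auto
  thus ?thesis using that T_preimage_in_R[OF y(2) x(1,2)] by (auto simp: P_def)
qed

text \<open>Every point of the finite set \<open>P m\<close> has a preimage in \<open>P m\<close>, so \<open>T\<close> must permute it.\<close>

lemma T_bij_betw_P: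
  assumes "m > 0"
  shows "bij_betw T (P m) (P m)"
proof -
  have sub: "P m \<subseteq> T ` P m" using P_surj[OF assms] by (metis image_eqI subsetI)
  have fin: "finite (P m)" by (rule finite_P[OF assms])
  have card: "card (T ` P m) \<le> card (P m)" by (rule card_image_le[OF fin])
  have "P m = T ` P m" using card_seteq[OF _ sub card] fin by blast
  moreover from this have "inj_on T (P m)" using eq_card_imp_inj_on[OF fin, of T] by argo
  ultimately show ?thesis by (auto simp: bij_betw_def)
qed

lemma P_periodic:
  assumes "m > 0" "x \<in> P m"
  obtains p where "p > 0" "(T ^^ p) x = x"
proof -
  have bij: "bij_betw (T ^^ n) (P m) (P m)" for n
    using bij_betw_funpow[OF T_bij_betw_P[OF assms(1)]] .
  have in_P: "(T ^^ n) x \<in> P m" for n using bij[of n] assms(2) by (auto simp: bij_betw_def)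
  have "\<not> inj (\<lambda>n. (T ^^ n) x)"
  proof
    assume "inj (\<lambda>n. (T ^^ n) x)"
    moreover have "range (\<lambda>n. (T ^^ n) x) \<subseteq> P m" using in_P by auto
    ultimately show False
      using finite_P[OF assms(1)] finite_imageD finite_subset by (metis infinite_UNIV_nat)
  qed
  then obtain i j where "i < j" "(T ^^ i) x = (T ^^ j) x"
    by (auto simp: inj_def) (metis linorder_neqE_nat)
  hence "(T ^^ i) ((T ^^ (j - i)) x) = (T ^^ i) x"
    by (simp flip: funpow_add comp_def[of "T ^^ i" "T ^^ (j - i)", THEN fun_cong])
  hence "(T ^^ (j - i)) x = x"
    using bij[of i] in_P[of "j - i"] assms(2) by (auto simp: bij_betw_def dest: inj_onD)
  thus ?thesis using that[of "j - i"] \<open>i < j\<close> by simp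
qed

text \<open>Of the tiles that make up the tile of \<open>T x\<close>, only that of \<open>x\<close> contains \<open>0\<close>.\<close>

lemma tile_local_step:
  assumes "m > 0" "x \<in> P m"
  shows "\<forall>\<^sub>F z in nhds 0. z \<in> tile x \<longleftrightarrow> \<alpha> * z \<in> tile (T x)"
proof -
  have Tx: "T x \<in> P m" using T_bij_betw_P[OF assms(1)] assms(2) by (auto simp: bij_betw_def)
  hence Tx': "T x \<in> {0<..1}" "T x \<in> K" "of_nat m * T x \<in> R"
    using P_in_K assms by (auto simp: P_def)
  define Y where "Y = {y \<in> {0<..1}. T y = T x \<and> y \<noteq> x}"
  have "Y \<subseteq> (\<lambda>a. (T x + of_int a) / \<beta>) ` digits (T x)"
    using left_map_iff[OF Tx'(1) beta_pos] by (force simp: Y_def digits_def)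
  hence "finite Y" using finite_digits finite_subset by blast
  hence "closed (\<Union>y\<in>Y. tile y)" by (intro closed_UN) (auto simp: closed_tile)
  moreover have "0 \<notin> tile y" if "y \<in> Y" for y
  proof
    assume "0 \<in> tile y"
    hence "y \<in> P m" using that T_preimage_in_R[of y "T x" m] Tx' by (auto simp: P_def Y_def)
    thus False using T_bij_betw_P[OF assms(1)] assms(2) that
      by (auto simp: bij_betw_def Y_def dest: inj_onD)
  qed
  ultimately have "open (- (\<Union>y\<in>Y. tile y))" "0 \<in> - (\<Union>y\<in>Y. tile y)"
    by (auto simp del: Compl_UN)
  hence "\<forall>\<^sub>F z in nhds 0. z \<in> - (\<Union>y\<in>Y. tile y)" by (rule eventually_nhds_in_open)
  thus ?thesis
  proof eventually_elim
    case (elim z)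
    have "\<alpha> * z \<in> tile (T x) \<longleftrightarrow> (\<exists>y\<in>{0<..1}. T y = T x \<and> z \<in> tile y)"
      using tile_rec[OF Tx'(1,2), of "\<alpha> * z"] by simp
    also have "\<dots> \<longleftrightarrow> z \<in> tile x"
      using elim assms(2) by (auto simp: Y_def P_def)
    finally show ?case by simp
  qed
qed

text \<open>One radius serves all points of the finite set \<open>P m\<close>, and since \<alpha> is
  a contraction, every \<open>\<alpha> ^ n * z\<close> remains in that disc.\<close>

lemma tile_local:
  assumes "m > 0"
  obtains \<epsilon> where "\<epsilon> > 0"
    "\<And>x z n. x \<in> P m \<Longrightarrow> cmod z < \<epsilon> \<Longrightarrow> z \<in> tile x \<longleftrightarrow> \<alpha> ^ n * z \<in> tile ((T ^^ n) x)"
proof -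
  have "\<forall>\<^sub>F z in nhds 0. \<forall>x\<in>P m. z \<in> tile x \<longleftrightarrow> \<alpha> * z \<in> tile (T x)"
    using tile_local_step[OF assms] finite_P[OF assms] by (intro eventually_ball_finite) auto
  then obtain \<epsilon> where \<epsilon>: "\<epsilon> > 0"
    "\<And>x z. x \<in> P m \<Longrightarrow> cmod z < \<epsilon> \<Longrightarrow> z \<in> tile x \<longleftrightarrow> \<alpha> * z \<in> tile (T x)"
    unfolding eventually_nhds_metric by (auto simp: dist_norm)
  show ?thesis
  proof (rule that[OF \<epsilon>(1)])
    fix x z n assume x: "x \<in> P m" and z: "cmod z < \<epsilon>"
    show "z \<in> tile x \<longleftrightarrow> \<alpha> ^ n * z \<in> tile ((T ^^ n) x)"
    proof (induction n)
      case (Suc n)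
      have "cmod (\<alpha> ^ n * z) \<le> cmod z"
        using alpha_less_1 by (simp add: norm_mult norm_power mult_left_le_one_le power_le_one)
      moreover have "(T ^^ n) x \<in> P m"
        using bij_betw_funpow[OF T_bij_betw_P[OF assms], of n] x by (auto simp: bij_betw_def)
      ultimately show ?case using Suc \<epsilon>(2)[of "(T ^^ n) x" "\<alpha> ^ n * z"] z
        by (simp add: mult.assoc)
    qed simp
  qed
qed

text \<open>Multiplying \<open>z\<close> by a suitable power of \<open>\<alpha>\<close> moves it close to the segment without
  affecting whether it belongs to the tile.\<close>

lemma spiral:
  assumes "m > 0" "r \<in> P m" "\<delta> > 0"
    and segment: "\<And>t. 0 \<le> t \<Longrightarrow> t \<le> \<delta> \<Longrightarrow> of_real t \<in> tile r"
  obtains \<eta> where "\<eta> > 0" "ball 0 \<eta> \<subseteq> tile r"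
proof -
  obtain \<epsilon> where \<epsilon>: "\<epsilon> > 0"
    "\<And>x z n. x \<in> P m \<Longrightarrow> cmod z < \<epsilon> \<Longrightarrow> z \<in> tile x \<longleftrightarrow> \<alpha> ^ n * z \<in> tile ((T ^^ n) x)"
    using tile_local[OF assms(1)] by metis
  obtain p where p: "p > 0" "(T ^^ p) r = r" using P_periodic[OF assms(1,2)] .
  have period: "(T ^^ (p * n)) r = r" for n
    using p(2) by (induction n) (simp_all add: funpow_add)
  have "z \<in> tile r" if z: "cmod z < min \<epsilon> \<delta>" for z
  proof -
    have "\<exists>y\<in>tile r. dist y z < e" if "e > 0" for e
    proof -
      \<comment> \<open>Division by \<open>q\<close> leaves an error of at most
        \<open>e' * cmod z\<close>; the summand 1 makes this strictly smaller than \<open>e\<close>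
        and admits \<open>z = 0\<close>.\<close>
      define e' where "e' = e / (cmod z + 1)"
      have "e' > 0" using that by (simp add: e'_def add_nonneg_pos)
      moreover have "(\<alpha> ^ p) ^ n \<notin> \<real>" if "n > 0" for n
        using sigma_beta_power_nonreal[of "p * n"] p(1) that by (simp add: power_mult)
      ultimately obtain n where
        n: "cmod ((\<alpha> ^ p) ^ n * z - of_real (cmod ((\<alpha> ^ p) ^ n * z))) \<le> e' * cmod ((\<alpha> ^ p) ^ n * z)"
        using powers_approach_positive_axis by blast
      define q where "q = \<alpha> ^ (p * n)"
      define t where "t = cmod (q * z)"
      have "q \<noteq> 0" by (simp add: q_def)
      have n': "cmod (q * z - of_real t) \<le> e' * t" using n by (simp add: q_def t_def power_mult)
      have "t = cmod \<alpha> ^ (p * n) * cmod z" by (simp add: t_def q_def norm_mult norm_power)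
      hence "t \<le> cmod z"
        using alpha_less_1 by (simp add: mult_left_le_one_le power_le_one)
      hence "of_real t \<in> tile r" using segment[of t] z by (simp add: t_def)
      \<comment> \<open>This quotient has the modulus of \<open>z\<close>, so the local equivalence
        can be read backwards, from \<open>t\<close> to \<open>t / q\<close>.\<close>
      moreover have "cmod (of_real t / q) < \<epsilon>"
        using z \<open>q \<noteq> 0\<close> by (simp add: t_def norm_divide norm_mult)
      ultimately have "of_real t / q \<in> tile r"
        using \<epsilon>(2)[OF assms(2), of "of_real t / q" "p * n"] period[of n] \<open>q \<noteq> 0\<close>
        by (simp add: q_def)
      moreover have "dist (of_real t / q) z < e"
      proof -
        have "z - of_real t / q = (q * z - of_real t) / q"
          using \<open>q \<noteq> 0\<close> by (simp add: field_simps)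
        hence "dist (of_real t / q) z = cmod (q * z - of_real t) / cmod q"
          by (simp add: dist_norm norm_minus_commute norm_divide)
        also have "\<dots> \<le> e' * t / cmod q" using n' by (simp add: divide_right_mono)
        also have "\<dots> = e' * cmod z" using \<open>q \<noteq> 0\<close> by (simp add: t_def norm_mult)
        also have "\<dots> < e"
        proof -
          have "cmod z + 1 > 0" by (simp add: add_nonneg_pos)
          thus ?thesis using that by (simp add: e'_def divide_less_eq algebra_simps)
        qed
        finally show ?thesis .
      qed
      ultimately show ?thesis by blast
    qed
    hence "z \<in> closure (tile r)" by (simp add: closure_approachable)
    thus ?thesis using closed_tile by simp
  qed
  hence "ball 0 (min \<epsilon> \<delta>) \<subseteq> tile r" by auto
  thus ?thesis using that[of "min \<epsilon> \<delta>"] \<epsilon>(1) assms(3) by auto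
qed

section \<open>Comparison with the original beta-transformation\<close>

abbreviation T0 :: "real \<Rightarrow> real" where "T0 \<equiv> beta_transformation \<beta>"

lemma T0_range: "T0 y \<in> {0..<1}"
  unfolding beta_transformation_def by (simp; linarith)

lemma T0_pow_range: "y \<in> {0..<1} \<Longrightarrow> (T0 ^^ n) y \<in> {0..<1}"
  using T0_range by (cases n) auto

lemma T0_0 [simp]: "T0 0 = 0"
  by (simp add: beta_transformation_def)

lemma T0_pow_0 [simp]: "(T0 ^^ n) 0 = 0"
  by (induction n) auto

lemma T0_pow_0_mono:
  assumes "(T0 ^^ n) x = 0" "n \<le> k"
  shows "(T0 ^^ k) x = 0"
  using assms(2,1) by (induction rule: dec_induct) auto

lemma T0_in_R: "x \<in> R \<Longrightarrow> T0 x \<in> R"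
  by (auto simp: beta_transformation_def intro!: R_diff R_mult beta_in_R)

lemma T0_pow_in_R: "x \<in> R \<Longrightarrow> (T0 ^^ n) x \<in> R"
  by (induction n) (auto simp: T0_in_R)

lemma T_in_R: "x \<in> R \<Longrightarrow> T x \<in> R"
  unfolding left_map_def by (intro R_diff R_mult beta_in_R R_of_int)

lemma T_pow_in_R: "x \<in> R \<Longrightarrow> (T ^^ n) x \<in> R"
  by (induction n) (auto simp: T_in_R)

text \<open>The maps differ only where \<beta> y is an integer; there \<open>T0\<close> gives 0 and
  \<open>T\<close> gives 1.\<close>

lemma T_eq_T0:
  assumes "T0 y \<noteq> 0 \<or> T y \<noteq> 1"
  shows "T y = T0 y"
proof (cases "T0 y = 0")
  case False
  hence "T0 y \<in> {0<..1}" using T0_range[of y] by auto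
  thus ?thesis by (rule left_map_eqI[where a = "\<lfloor>\<beta> * y\<rfloor>"]) (simp add: beta_transformation_def)
next
  case True
  hence "\<beta> * y = of_int \<lfloor>\<beta> * y\<rfloor>" by (simp add: beta_transformation_def)
  hence "T y = 1" by (intro left_map_eqI[where a = "\<lfloor>\<beta> * y\<rfloor> - 1"]) auto
  thus ?thesis using assms True by simp
qed

section \<open>Dependence of the tiles on the base point\<close>

text \<open>\<open>B k x\<close> can only change when \<open>x\<close> crosses a point of this finite set.\<close>

definition \<Theta> :: "real set" where "\<Theta> = {g \<in> R. \<bar>g\<bar> \<le> 1 \<and> cmod (\<sigma> g) \<le> C}"

lemma finite_Theta: "finite \<Theta>"
  unfolding \<Theta>_def by (rule R_discrete)

text \<open>The point \<beta> - a is the last \<open>x\<close> for which \<open>a\<close> is an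
  admissible digit, hence the basic threshold.\<close>

lemma beta_minus_digit_bound:
  assumes "\<bar>of_int a :: real\<bar> \<le> \<beta>"
  shows "cmod (\<sigma> (\<beta> - of_int a)) \<le> C"
  using C_step[of 1 "- a"] C_ge beta_gt_1 assms by (simp add: sigma_diff)

text \<open>Transports a threshold for the preimage (x + a) / \<beta> to one for x without leaving
  the disc of radius \<open>C\<close>.\<close>

lemma affine_bound:
  assumes "g \<in> R" "cmod (\<sigma> g) \<le> C" "\<bar>of_int a :: real\<bar> \<le> \<beta>"
  shows "cmod (\<sigma> (\<beta> * g - of_int a)) \<le> C"
  using C_step[of "\<sigma> g" "- a"] assms by (simp add: sigma_diff R_in_K K_mult)

text \<open>An element is lost either because its last digit becomes inadmissible, which puts
  \<beta> - a into [x, s), or because it is lost at the preimage, whose threshold is then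
  transported. The bound on the absolute value in \<Theta> is left out of the induction and
  recovered from the position between \<open>x\<close> and \<open>s\<close>.\<close>

lemma threshold:
  assumes "x \<in> {0<..1}" "x \<le> s" "s \<le> 1" "N \<in> B k x" "N \<notin> B k s"
  shows "\<exists>g\<in>\<Theta>. x \<le> g \<and> g < s"
proof -
  have "\<exists>g\<in>R. cmod (\<sigma> g) \<le> C \<and> x \<le> g \<and> g < s"
    using assms
  proof (induction k arbitrary: x s N)
    case 0
    thus ?case by simp
  next
    case (Suc k)
    then obtain N1 and a :: int where *: "N = \<beta> * N1 + of_int a"
      "(x + of_int a) / \<beta> \<in> {0<..1}" "N1 \<in> B k ((x + of_int a) / \<beta>)"
      by auto
    note a = digit_bound[OF Suc.prems(1) *(2)]
    have xa: "x + of_int a \<le> \<beta>" "0 < x + of_int a"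
      using *(2) beta_gt_1 by (auto simp: zero_less_divide_iff divide_le_eq)
    show ?case
    proof (cases "s + of_int a \<le> \<beta>")
      case False
      thus ?thesis using beta_minus_digit_bound[OF a(2)] xa
        by (intro bexI[of _ "\<beta> - of_int a"]) (auto intro: R_diff beta_in_R)
    next
      case True
      hence s': "(s + of_int a) / \<beta> \<in> {0<..1}" using xa Suc.prems(2) by simp
      hence "N1 \<notin> B k ((s + of_int a) / \<beta>)" using Suc.prems(5) *(1) by auto
      moreover have "(x + of_int a) / \<beta> \<le> (s + of_int a) / \<beta>"
        using Suc.prems(2) by (intro divide_right_mono) auto
      ultimately obtain g where g: "g \<in> R" "cmod (\<sigma> g) \<le> C"
        "(x + of_int a) / \<beta> \<le> g" "g < (s + of_int a) / \<beta>"
        using Suc.IH[OF *(2) _ _ *(3), of "(s + of_int a) / \<beta>"] s' by auto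
      hence "x \<le> \<beta> * g - of_int a" "\<beta> * g - of_int a < s"
        by (auto simp: field_simps)
      moreover have "\<beta> * g - of_int a \<in> R"
        using g by (intro R_diff R_mult beta_in_R R_of_int)
      ultimately show ?thesis using affine_bound[OF g(1,2) a(2)] by blast
    qed
  qed
  thus ?thesis using assms(1,3) by (force simp: \<Theta>_def)
qed

text \<open>Moving the base point to the left only relaxes the upper condition on a digit; the lower
  one persists because digits are non-negative.\<close>

lemma B_antimono:
  assumes "x \<in> {0<..1}" "x \<le> s" "s \<le> 1" "N \<in> B k s"
  shows "N \<in> B k x"
  using assms
proof (induction k arbitrary: x s N)
  case (Suc k)
  have s: "s \<in> {0<..1}" using Suc.prems by auto
  obtain N1 and a :: int where *: "N = \<beta> * N1 + of_int a"
    "(s + of_int a) / \<beta> \<in> {0<..1}" "N1 \<in> B k ((s + of_int a) / \<beta>)"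
    using Suc.prems(4) by auto
  have "0 < x + of_int a" using digit_bound(1)[OF s *(2)] Suc.prems(1) by (simp add: add_pos_nonneg)
  moreover have le: "(x + of_int a) / \<beta> \<le> (s + of_int a) / \<beta>"
    using Suc.prems(2) by (intro divide_right_mono) auto
  ultimately have x': "(x + of_int a) / \<beta> \<in> {0<..1}"
    using *(2) by (meson greaterThanAtMost_iff divide_pos_pos beta_pos order_trans)
  hence "N1 \<in> B k ((x + of_int a) / \<beta>)"
    using Suc.IH[OF x' le] *(2,3) by auto
  thus ?case using *(1) x' by auto
qed auto

lemma S_eqI:
  assumes "x \<in> {0<..1}" "x \<le> s" "s \<le> 1" "\<And>g. g \<in> \<Theta> \<Longrightarrow> x \<le> g \<Longrightarrow> g < s \<Longrightarrow> False"
  shows "S x = S s"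
proof -
  have "B k x = B k s" for k
    using threshold[OF assms(1-3)] B_antimono[OF assms(1-3)] assms(4) by blast
  thus ?thesis by (simp add: S_def)
qed

text \<open>Counterpart of \<open>threshold\<close> for an orbit of \<open>T0\<close>, which may end
  in 0, where there is no tile. The lower bound is strict because \<open>T0\<close> stays below 1;
  this matters, since 0 itself belongs to \<Theta>.\<close>

lemma threshold_0:
  assumes "y \<in> {0..<1}" "(T0 ^^ k) y < s" "s \<le> 1" "\<beta> ^ k * y - (T0 ^^ k) y \<notin> B k s"
  shows "\<exists>g\<in>\<Theta>. (T0 ^^ k) y < g \<and> g < s"
proof -
  have "\<exists>g\<in>R. cmod (\<sigma> g) \<le> C \<and> (T0 ^^ k) y < g \<and> g < s"
    using assms(2-4)
  proof (induction k arbitrary: s)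
    case 0
    thus ?case by simp
  next
    case (Suc k)
    define u where "u = (T0 ^^ k) y"
    define x where "x = T0 u"
    define a where "a = \<lfloor>\<beta> * u\<rfloor>"
    have u: "0 \<le> u" "u < 1" using T0_pow_range[OF assms(1), of k] by (auto simp: u_def)
    have x: "x = \<beta> * u - of_int a" "(T0 ^^ Suc k) y = x"
      by (simp_all add: x_def a_def beta_transformation_def u_def)
    have "0 \<le> x" using T0_range[of u] by (simp add: x_def)
    have "\<beta> * u < \<beta>" using u by simp
    have "a \<ge> 0" using u by (simp add: a_def)
    moreover have "of_int a \<le> \<beta> * u" unfolding a_def by (rule of_int_floor_le)
    ultimately have a: "\<bar>of_int a :: real\<bar> \<le> \<beta>"
      using \<open>\<beta> * u < \<beta>\<close> by linarith
    show ?case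
    proof (cases "s + of_int a \<le> \<beta>")
      case False
      thus ?thesis using beta_minus_digit_bound[OF a] x \<open>\<beta> * u < \<beta>\<close>
        by (intro bexI[of _ "\<beta> - of_int a"]) (auto intro: R_diff beta_in_R)
    next
      case True
      have "s > 0" using Suc.prems(1) \<open>0 \<le> x\<close> x by simp
      hence s': "(s + of_int a) / \<beta> \<in> {0<..1}"
        using True \<open>a \<ge> 0\<close> by (simp add: add_pos_nonneg)
      have "\<beta> ^ Suc k * y - (T0 ^^ Suc k) y = \<beta> * (\<beta> ^ k * y - u) + of_int a"
        unfolding x(2) unfolding x(1) by (simp add: algebra_simps)
      hence "\<beta> ^ k * y - u \<notin> B k ((s + of_int a) / \<beta>)" using Suc.prems(3) s' by auto
      moreover have "u < (s + of_int a) / \<beta>"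
        using Suc.prems(1) x by (simp add: field_simps)
      ultimately obtain g where g: "g \<in> R" "cmod (\<sigma> g) \<le> C" "u < g" "g < (s + of_int a) / \<beta>"
        using Suc.IH[of "(s + of_int a) / \<beta>"] s' by (auto simp: u_def)
      have "\<beta> * g - of_int a < s" using g(4) by (simp add: field_simps)
      moreover have "x < \<beta> * g - of_int a" using g(3) by (simp add: x(1))
      moreover have "\<beta> * g - of_int a \<in> R"
        using g by (intro R_diff R_mult beta_in_R R_of_int)
      ultimately show ?thesis using affine_bound[OF g(1,2) a] x(2) by metis
    qed
  qed
  moreover have "0 \<le> (T0 ^^ k) y" using T0_pow_range[OF assms(1), of k] by simp
  ultimately show ?thesis using assms(3) by (force simp: \<Theta>_def)
qed

text \<open>The difference is a polynomial in \<alpha> whose coefficients are digits, evaluated by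
  Horner's scheme inside the disc of radius \<open>C\<close>.\<close>

lemma T0_sigma_bound:
  assumes "y \<in> R" "y \<in> {0..<1}"
  shows "cmod (\<alpha> ^ k * \<sigma> y - \<sigma> ((T0 ^^ k) y)) \<le> C"
proof (induction k)
  case 0
  thus ?case using C_ge beta_gt_1 by simp
next
  case (Suc k)
  define u where "u = (T0 ^^ k) y"
  define a where "a = \<lfloor>\<beta> * u\<rfloor>"
  have u: "0 \<le> u" "u < 1" "u \<in> K"
    using T0_pow_range[OF assms(2), of k] T0_pow_in_R[OF assms(1), of k] by (auto simp: u_def)
  have "\<beta> * u < \<beta>" using u by simp
  moreover have "a \<ge> 0" using u by (simp add: a_def)
  moreover have "of_int a \<le> \<beta> * u" unfolding a_def by (rule of_int_floor_le)
  ultimately have a: "\<bar>of_int a :: real\<bar> \<le> \<beta> + 1" using \<open>\<beta> * u < \<beta>\<close> by linarith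
  have "\<sigma> (T0 u) = \<alpha> * \<sigma> u - of_int a"
    using u by (simp add: beta_transformation_def a_def sigma_diff K_mult)
  hence "\<alpha> ^ Suc k * \<sigma> y - \<sigma> ((T0 ^^ Suc k) y) = \<alpha> * (\<alpha> ^ k * \<sigma> y - \<sigma> u) + of_int a"
    by (simp add: u_def algebra_simps)
  thus ?case using C_step[OF Suc.IH a] by (simp add: u_def)
qed

lemma power_beta_unbounded: "\<exists>k. x < \<beta> ^ k"
  using real_arch_pow[OF beta_gt_1] .

lemma alpha_power_small:
  assumes "e > 0"
  shows "\<exists>k0. \<forall>k\<ge>k0. cmod (\<alpha> ^ k) < e"
proof -
  have "(\<lambda>k. cmod \<alpha> ^ k) \<longlonglongrightarrow> 0" using alpha_less_1 by (intro LIMSEQ_realpow_zero) auto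
  hence "\<forall>\<^sub>F k in sequentially. cmod \<alpha> ^ k < e" using assms by (rule order_tendstoD)
  thus ?thesis by (simp add: eventually_sequentially norm_power)
qed

section \<open>Consequences of property (F)\<close>

text \<open>The fractional parts of all \<open>w\<close> with bounded \<open>\<sigma> w\<close> lie in a finite set, so their finite
  expansions have a common length bound \<open>L\<close>. Multiplying by \<open>\<beta>\<^sup>L\<close> removes the fractional part.\<close>

lemma small_elements_are_integer_parts:
  obtains \<epsilon> \<delta> where "\<epsilon> > 0" "\<delta> > 0" "\<delta> \<le> 1"
    "\<And>w s. w \<in> R \<Longrightarrow> 0 \<le> w \<Longrightarrow> cmod (\<sigma> w) < \<epsilon> \<Longrightarrow> 0 < s \<Longrightarrow> s < \<delta> \<Longrightarrow> \<exists>k. w \<in> B k s"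
proof -
  \<comment> \<open>The bound \<open>C + 1\<close> is the \<open>C\<close> of
    \<open>T0_sigma_bound\<close> plus 1 for the conjugate of the rescaled element
    \<open>w\<close>.\<close>
  define F where "F = {f \<in> R. \<bar>f\<bar> \<le> 1 \<and> cmod (\<sigma> f) \<le> C + 1} \<inter> {0..<1}"
  have "finite F" unfolding F_def using R_discrete by blast
  moreover have "\<exists>n. (T0 ^^ n) f = 0" if "f \<in> F" for f
    using finite_expansion that by (auto simp: F_def)
  then obtain n where n: "\<And>f. f \<in> F \<Longrightarrow> (T0 ^^ n f) f = 0" by metis
  ultimately obtain L where "\<forall>f\<in>F. n f \<le> L"
    by (meson finite_nat_set_iff_bounded_le finite_imageI imageI)
  hence L: "(T0 ^^ L) f = 0" if "f \<in> F" for f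
    using n[OF that] T0_pow_0_mono that by blast
  \<comment> \<open>Below this distance there is no positive threshold, so nothing is lost between
    the fractional part 0 and \<open>s\<close>.\<close>
  obtain \<delta>0 where \<delta>0: "\<delta>0 > 0" "\<forall>g\<in>\<Theta>. g \<noteq> 0 \<longrightarrow> \<delta>0 \<le> dist 0 g"
    using finite_set_avoid[OF finite_Theta, of 0] by blast
  define \<delta> where "\<delta> = min \<delta>0 1"
  have "\<exists>k. w' \<in> B k s" if w': "w' \<in> R" "0 \<le> w'" "cmod (\<sigma> w') < cmod (\<alpha> ^ L)"
    and s: "0 < s" "s < \<delta>" for w' s
  proof -
    define w where "w = w' / \<beta> ^ L"
    have w: "w \<in> R" "w \<ge> 0" using w' by (auto simp: w_def R_divide_beta_power)
    have "\<sigma> w = \<sigma> w' / \<alpha> ^ L"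
      using w' by (simp add: w_def sigma_divide R_in_K K_power sigma_power)
    hence w_small: "cmod (\<sigma> w) \<le> 1"
      using w'(3) by (simp add: norm_divide norm_power divide_le_eq)
    obtain K where K: "w < \<beta> ^ K" using power_beta_unbounded by blast
    define y where "y = w / \<beta> ^ K"
    have y: "y \<in> R" "y \<in> {0..<1}"
      using w K by (auto simp: y_def R_divide_beta_power divide_less_eq)
    have "\<alpha> ^ K * \<sigma> y = \<sigma> w"
      using w by (simp add: y_def sigma_divide R_in_K K_power sigma_power)
    hence "cmod (\<sigma> w - \<sigma> ((T0 ^^ K) y)) \<le> C"
      using T0_sigma_bound[OF y, of K] by simp
    hence "cmod (\<sigma> ((T0 ^^ K) y)) \<le> C + 1"
      using w_small norm_triangle_ineq3[of "\<sigma> w" "\<sigma> ((T0 ^^ K) y)"] by linarith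
    hence "(T0 ^^ K) y \<in> F"
      using T0_pow_range[OF y(2), of K] T0_pow_in_R[OF y(1), of K] by (auto simp: F_def)
    hence zero: "(T0 ^^ (L + K)) y = 0" using L by (simp add: funpow_add)
    have w'_eq: "\<beta> ^ (L + K) * y = w'" by (simp add: y_def w_def power_add)
    have "w' \<in> B (L + K) s"
    proof (rule ccontr)
      assume "w' \<notin> B (L + K) s"
      hence "\<exists>g\<in>\<Theta>. 0 < g \<and> g < s"
        using threshold_0[OF y(2), of "L + K" s] zero w'_eq s by (auto simp: \<delta>_def)
      thus False using \<delta>0(2) s by (force simp: \<delta>_def dist_real_def)
    qed
    thus ?thesis ..
  qed
  thus ?thesis using that[of "cmod (\<alpha> ^ L)" \<delta>] \<delta>0(1) by (simp add: \<delta>_def)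
qed

text \<open>The integer combinations of \<alpha>^n and \<alpha>^(n+1) form a lattice of arbitrarily
  small mesh. Adding a high power of \<beta> makes the element non-negative and hardly moves its
  conjugate.\<close>

lemma sigma_dense:
  assumes "e > 0"
  shows "\<exists>w\<in>R. w \<ge> 0 \<and> cmod (\<sigma> w - z) < e"
proof -
  obtain n where n: "cmod (\<alpha> ^ n) < e / 4"
    using alpha_power_small[of "e / 4"] assms by auto
  define v where "v = z / \<alpha> ^ n"
  have "Im \<alpha> \<noteq> 0"
    using sigma_beta_power_nonreal[of 1] by (simp add: complex_is_Real_iff)
  define y where "y = Im v / Im \<alpha>"
  define x where "x = Re v - y * Re \<alpha>"
  have v: "v = of_real x + of_real y * \<alpha>"
    using \<open>Im \<alpha> \<noteq> 0\<close> by (simp add: complex_eq_iff x_def y_def)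
  define w0 where "w0 = \<beta> ^ n * (of_int \<lfloor>x\<rfloor> + of_int \<lfloor>y\<rfloor> * \<beta>)"
  have w0: "w0 \<in> R"
    unfolding w0_def by (intro R_mult R_add R_beta_power R_of_int beta_in_R)
  have "\<sigma> w0 = \<alpha> ^ n * (of_int \<lfloor>x\<rfloor> + of_int \<lfloor>y\<rfloor> * \<alpha>)"
    by (simp add: w0_def sigma_mult sigma_add K_mult K_add K_power sigma_power)
  moreover have "z = \<alpha> ^ n * v" by (simp add: v_def)
  ultimately have "z - \<sigma> w0 = \<alpha> ^ n * (of_real (frac x) + of_real (frac y) * \<alpha>)"
    by (simp add: v frac_def algebra_simps)
  hence "cmod (z - \<sigma> w0) = cmod (\<alpha> ^ n) * cmod (of_real (frac x) + of_real (frac y) * \<alpha>)"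
    by (simp add: norm_mult)
  also have "\<dots> \<le> cmod (\<alpha> ^ n) * 2"
  proof (intro mult_left_mono)
    have "cmod (of_real (frac x) + of_real (frac y) * \<alpha>) \<le> frac x + frac y * cmod \<alpha>"
      by (rule order_trans[OF norm_triangle_ineq]) (simp add: norm_mult)
    also have "\<dots> \<le> 1 + 1 * 1"
      using alpha_less_1 by (intro add_mono mult_mono) (auto simp: less_imp_le[OF frac_lt_1])
    finally show "cmod (of_real (frac x) + of_real (frac y) * \<alpha>) \<le> 2" by simp
  qed simp
  finally have 1: "cmod (z - \<sigma> w0) < e / 2" using n by simp
  obtain k0 where k0: "\<And>k. k \<ge> k0 \<Longrightarrow> cmod (\<alpha> ^ k) < e / 2"
    using alpha_power_small[of "e / 2"] assms by auto
  obtain k1 where k1: "\<bar>w0\<bar> < \<beta> ^ k1" using power_beta_unbounded by blast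
  define m where "m = max k0 k1"
  have "\<beta> ^ k1 \<le> \<beta> ^ m" using beta_gt_1 by (intro power_increasing) (auto simp: m_def)
  hence "w0 + \<beta> ^ m \<ge> 0" using k1 by linarith
  moreover have "cmod (\<sigma> (w0 + \<beta> ^ m) - z) < e"
  proof -
    have eq: "\<sigma> (w0 + \<beta> ^ m) - z = \<alpha> ^ m - (z - \<sigma> w0)"
      using w0 by (simp add: sigma_add R_in_K K_power sigma_power)
    have "cmod (\<alpha> ^ m) < e / 2" by (rule k0) (simp add: m_def)
    thus ?thesis
      unfolding eq using norm_triangle_ineq4[of "\<alpha> ^ m" "z - \<sigma> w0"] 1 by linarith
  qed
  ultimately show ?thesis using R_add[OF w0 R_beta_power] by blast
qed

text \<open>For small \<open>s\<close> the set \<open>S s\<close> contains every conjugate of a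
  non-negative element of \<open>R\<close> inside a fixed disc around 0. These are dense there, and
  the disc contains \<open>-s\<close>.\<close>

lemma G_near_0:
  obtains \<delta> where "\<delta> > 0" "\<delta> \<le> 1" "\<And>s. 0 < s \<Longrightarrow> s < \<delta> \<Longrightarrow> - of_real s \<in> G s"
proof -
  obtain \<epsilon> \<delta> where *: "\<epsilon> > 0" "\<delta> > 0" "\<delta> \<le> 1"
    "\<And>w s. w \<in> R \<Longrightarrow> 0 \<le> w \<Longrightarrow> cmod (\<sigma> w) < \<epsilon> \<Longrightarrow> 0 < s \<Longrightarrow> s < \<delta> \<Longrightarrow> \<exists>k. w \<in> B k s"
    using small_elements_are_integer_parts by blast
  have "- of_real s \<in> G s" if s: "0 < s" "s < min \<delta> \<epsilon>" for s
    unfolding G_def closure_approachable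
  proof (intro allI impI)
    fix e :: real assume "e > 0"
    hence "min e (\<epsilon> - s) > 0" using s by simp
    then obtain w where w: "w \<in> R" "w \<ge> 0" "cmod (\<sigma> w - (- of_real s)) < min e (\<epsilon> - s)"
      using sigma_dense by blast
    have "cmod (\<sigma> w) \<le> cmod (\<sigma> w - (- of_real s)) + cmod (- of_real s)"
      by (metis norm_triangle_sub add.commute)
    hence "cmod (\<sigma> w) < \<epsilon>" using w s by simp
    hence "\<sigma> w \<in> S s" using *(4)[OF w(1,2) _ s(1)] s(2) by (auto simp: S_def)
    moreover have "dist (\<sigma> w) (- of_real s) < e" using w(3) by (simp add: dist_norm)
    ultimately show "\<exists>y\<in>S s. dist y (- of_real s) < e" by blast
  qed
  thus ?thesis using that[of "min \<delta> \<epsilon>"] *(1-3) by auto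
qed

lemma T_1_neq_1: "T 1 \<noteq> 1"
proof
  assume "T 1 = 1"
  hence "\<beta> = of_int \<lceil>\<beta>\<rceil>" by (simp add: left_map_def)
  thus False using beta_not_int by blast
qed

lemma T_pow_scale:
  assumes "0 < y" "\<beta> ^ j * y \<le> 1"
  shows "(T ^^ j) y = \<beta> ^ j * y"
  using assms(2)
proof (induction j)
  case (Suc j)
  have "\<beta> ^ j * y \<le> \<beta> ^ Suc j * y"
    using assms(1) beta_gt_1 by (intro mult_right_mono power_increasing) auto
  hence "\<beta> ^ j * y \<le> 1" using Suc.prems by linarith
  hence "(T ^^ j) y = \<beta> ^ j * y" by (rule Suc.IH)
  moreover have "T (\<beta> ^ j * y) = \<beta> ^ Suc j * y"
    using Suc.prems assms(1) by (intro left_map_eqI[where a = 0]) auto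
  ultimately show ?case by simp
qed simp

text \<open>Near \<open>\<alpha>\<^sup>l\<close> property (F) forces every large \<open>N + 1\<close> in \<open>\<int>[\<beta>]\<close> to be \<open>\<beta>\<^sup>L w + \<beta>\<^sup>l\<close> with an integer part
  \<open>w\<close>; its fractional part is then the \<open>l\<close>-th iterate of \<open>1\<close>. If \<open>-1\<close> were interior to \<open>G 1\<close>, some such
  \<open>N + 1\<close> would also have fractional part \<open>1\<close>.\<close>

lemma minus_1_not_interior_G_1:
  assumes "\<eta> > 0"
  shows "\<not> ball (-1) \<eta> \<subseteq> G 1"
proof
  assume ball: "ball (-1) \<eta> \<subseteq> G 1"
  obtain \<epsilon> \<delta> where \<epsilon>\<delta>: "\<epsilon> > 0" "\<delta> > 0" "\<delta> \<le> 1"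
    "\<And>w s. w \<in> R \<Longrightarrow> 0 \<le> w \<Longrightarrow> cmod (\<sigma> w) < \<epsilon> \<Longrightarrow> 0 < s \<Longrightarrow> s < \<delta> \<Longrightarrow> \<exists>k. w \<in> B k s"
    using small_elements_are_integer_parts by blast
  obtain l0 where l0: "\<And>k. k \<ge> l0 \<Longrightarrow> cmod (\<alpha> ^ k) < \<eta>"
    using alpha_power_small[OF assms] by blast
  \<comment> \<open>If iterate \<open>l0\<close> returns to 1, the next one does not, because 1 is
    not a fixed point.\<close>
  obtain l where l: "l \<ge> l0" "(T ^^ l) 1 \<noteq> 1"
  proof (cases "(T ^^ l0) 1 = 1")
    case True
    hence "(T ^^ Suc l0) 1 \<noteq> 1" using T_1_neq_1 by simp
    thus ?thesis using that[of "Suc l0"] by simp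
  qed (use that in blast)
  obtain j where j: "1 / \<delta> < \<beta> ^ j" using power_beta_unbounded by blast
  \<comment> \<open>The base point \<open>s\<close> has to be small for the integer-part property,
    and it reaches 1 after \<open>j\<close> steps, so iterate \<open>L\<close> of \<open>s\<close>
    is iterate \<open>l\<close> of 1.\<close>
  define L where "L = j + l"
  define s where "s = 1 / \<beta> ^ j"
  have s: "s > 0" "s < \<delta>" using j \<epsilon>\<delta> by (auto simp: s_def field_simps)
  define c where "c = \<alpha> ^ l - 1"
  have "c \<in> ball (-1) \<eta>" using l0[OF l(1)] by (simp add: c_def dist_norm norm_minus_commute)
  hence "c \<in> interior (G 1)" using ball by (meson interiorI open_ball)
  hence "c islimpt G 1" by (rule interior_limit_point)
  hence "c islimpt S 1" by (simp add: G_def limpt_of_closure)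
  moreover have "\<epsilon> * cmod (\<alpha> ^ L) > 0" using \<epsilon>\<delta>(1) by simp
  ultimately have "infinite (S 1 \<inter> ball c (\<epsilon> * cmod (\<alpha> ^ L)))"
    using islimpt_eq_infinite_ball by blast
  \<comment> \<open>Infinitely many candidates are available near \<open>c\<close>; leaving out the
    finitely many with \<open>N\<close> at most \<open>\<beta> ^ l\<close> makes \<open>w\<close>
    below non-negative.\<close>
  moreover have "finite (\<sigma> ` {N \<in> R. \<bar>N\<bar> \<le> \<beta> ^ l \<and> cmod (\<sigma> N) \<le> C})"
    using R_discrete by blast
  ultimately obtain z where z: "z \<in> S 1" "dist c z < \<epsilon> * cmod (\<alpha> ^ L)"
    "z \<notin> \<sigma> ` {N \<in> R. \<bar>N\<bar> \<le> \<beta> ^ l \<and> cmod (\<sigma> N) \<le> C}"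
    by (metis (no_types, lifting) IntD1 IntD2 finite_subset mem_ball subsetI)
  then obtain k N where N: "N \<in> B k 1" "z = \<sigma> N" by (auto simp: S_def)
  have "N \<in> R" "N \<ge> 0" "cmod (\<sigma> N) \<le> C"
    using B_in_R[OF N(1)] int_parts_nonneg[OF _ _ N(1)] B_bound[OF _ N(1)] by auto
  hence N_large: "N > \<beta> ^ l" using z(3) N(2) by (auto simp: image_iff)
  define w where "w = (N + 1 - \<beta> ^ l) / \<beta> ^ L"
  have w: "w \<in> R" "w \<ge> 0"
    using \<open>N \<in> R\<close> N_large
    by (auto simp: w_def intro!: R_divide_beta_power R_diff R_add R_beta_power)
  have "\<sigma> w = (z - c) / \<alpha> ^ L"
    using \<open>N \<in> R\<close> N(2)
    by (simp add: w_def c_def sigma_divide sigma_diff sigma_add K_diff K_add K_power R_in_K sigma_power)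
  hence "cmod (\<sigma> w) < \<epsilon>"
    using z(2) by (simp add: norm_divide dist_norm norm_minus_commute divide_less_eq)
  then obtain k' where "w \<in> B k' s" using \<epsilon>\<delta>(4)[OF w _ s] by blast
  moreover have "s \<in> {0<..1}" using s \<epsilon>\<delta>(3) by auto
  ultimately obtain y1 where y1: "y1 \<in> {0<..1}" "(T ^^ k') y1 = s" "w = \<beta> ^ k' * y1 - s"
    using int_parts_iff[of s \<beta>] by auto
  have "\<beta> ^ L * s = \<beta> ^ l" by (simp add: L_def s_def power_add)
  hence y1_eq: "\<beta> ^ (L + k') * y1 = N + 1"
    using y1(3) by (simp add: w_def power_add field_simps)
  have "(T ^^ j) s = 1" using T_pow_scale[OF s(1), of j] by (simp add: s_def)
  hence T_y1: "(T ^^ (L + k')) y1 \<noteq> 1"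
    using l(2) y1(2) by (simp add: L_def funpow_add funpow_swap1 add.commute[of j l])
  \<comment> \<open>At this higher level \<open>N\<close> comes from a point \<open>y\<close> with
    \<open>\<beta> ^ k * y = y1\<close>. So \<open>y\<close> runs into \<open>y1\<close>, and both
    descriptions of \<open>N + 1\<close> concern the same orbit.\<close>
  have "N \<in> B (k + (L + k')) 1"
    using int_parts_mono[OF _ _ N(1)] beta_gt_1 by simp
  then obtain y where y: "y \<in> {0<..1}" "(T ^^ (k + (L + k'))) y = 1"
    "N = \<beta> ^ (k + (L + k')) * y - 1"
    using int_parts_iff[of 1 \<beta>] by auto
  have "\<beta> ^ (L + k') * (\<beta> ^ k * y) = \<beta> ^ (L + k') * y1"
    using y(3) y1_eq by (simp add: power_add mult_ac)
  hence "\<beta> ^ k * y = y1" by simp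
  moreover from this have "(T ^^ k) y = \<beta> ^ k * y" using y(1) y1(1) by (intro T_pow_scale) auto
  ultimately have "(T ^^ (L + k')) y1 = 1"
    using y(2) by (simp add: funpow_add add.commute[of k])
  thus False using T_y1 by contradiction
qed

section \<open>Rational points\<close>

lemma T0_pow_beta_expansion:
  "beta_expansion \<beta> x (Suc n) = \<lfloor>\<beta> * (T0 ^^ n) x\<rfloor>"
  by (simp add: beta_expansion_def)

text \<open>Equal digits multiply the distance of the two orbits by \<beta> in every step, although
  it never reaches 1.\<close>

lemma beta_expansion_inj:
  assumes "x \<in> {0..<1}" "y \<in> {0..<1}" "\<And>n. n \<ge> 1 \<Longrightarrow> beta_expansion \<beta> x n = beta_expansion \<beta> y n"
  shows "x = y"
proof (rule ccontr)
  assume "x \<noteq> y"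
  have eq: "(T0 ^^ n) x - (T0 ^^ n) y = \<beta> ^ n * (x - y)" for n
  proof (induction n)
    case (Suc n)
    have "\<lfloor>\<beta> * (T0 ^^ n) x\<rfloor> = \<lfloor>\<beta> * (T0 ^^ n) y\<rfloor>"
      using assms(3)[of "Suc n"] by (simp add: T0_pow_beta_expansion)
    hence "(T0 ^^ Suc n) x - (T0 ^^ Suc n) y = \<beta> * ((T0 ^^ n) x - (T0 ^^ n) y)"
      by (simp add: beta_transformation_def algebra_simps)
    thus ?case by (simp add: Suc)
  qed simp
  obtain n where "1 / \<bar>x - y\<bar> < \<beta> ^ n" using power_beta_unbounded by blast
  hence "1 < \<beta> ^ n * \<bar>x - y\<bar>" using \<open>x \<noteq> y\<close> by (simp add: field_simps)
  hence "1 < \<bar>\<beta> ^ n * (x - y)\<bar>" by (simp add: abs_mult)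
  moreover have "\<bar>(T0 ^^ n) x - (T0 ^^ n) y\<bar> < 1"
    using T0_pow_range[OF assms(1), of n] T0_pow_range[OF assms(2), of n] by auto
  ultimately show False using eq by simp
qed

lemma purely_periodic_iff:
  assumes "x \<in> {0..<1}"
  shows "purely_periodic (beta_expansion \<beta> x) \<longleftrightarrow> (\<exists>p>0. (T0 ^^ p) x = x)"
proof -
  have shift: "beta_expansion \<beta> x (n + p) = beta_expansion \<beta> ((T0 ^^ p) x) n" if "n \<ge> 1" for n p
  proof -
    have "n + p - 1 = (n - 1) + p" using that by simp
    thus ?thesis by (simp add: beta_expansion_def funpow_add)
  qed
  show ?thesis
  proof
    assume "purely_periodic (beta_expansion \<beta> x)"
    then obtain p where p: "p > 0" "\<And>n. n \<ge> 1 \<Longrightarrow> beta_expansion \<beta> x (n + p) = beta_expansion \<beta> x n"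
      by (auto simp: purely_periodic_def)
    hence "(T0 ^^ p) x = x"
      using shift T0_pow_range[OF assms] assms by (intro beta_expansion_inj) auto
    thus "\<exists>p>0. (T0 ^^ p) x = x" using p by blast
  next
    assume "\<exists>p>0. (T0 ^^ p) x = x"
    thus "purely_periodic (beta_expansion \<beta> x)"
      using shift by (force simp: purely_periodic_def)
  qed
qed

lemma funpow_mult_fixed: "(f ^^ p) x = x \<Longrightarrow> (f ^^ (p * n)) x = x"
  by (induction n) (simp_all add: funpow_add)

lemma Rats_in_P:
  assumes "s \<in> \<rat>" "s \<in> {0<..1}" "0 \<in> tile s"
  obtains m where "m > 0" "s \<in> P m"
proof -
  obtain a b :: int where ab: "b > 0" "s = of_int a / of_int b"
    using assms(1) by (elim Rats_cases') auto
  hence "of_nat (nat b) * s = of_int a" by simp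
  hence "s \<in> P (nat b)" using assms(2,3) by (simp add: P_def)
  thus ?thesis using that[of "nat b"] ab by simp
qed

text \<open>A period p of s yields the points \<alpha>^(p n) s - s of \<open>S s\<close>, which tend
  to -s. Conversely, 0 in the tile makes s periodic under \<open>T\<close>. Its orbit avoids 1,
  since otherwise s would be an iterate of 1 and thus a rational element of \<open>R\<close> below
  1; hence \<open>T\<close> and \<open>T0\<close> agree along it.\<close>

lemma purely_periodic_Rats_iff:
  assumes "s \<in> \<rat>" "0 < s" "s < 1"
  shows "purely_periodic (beta_expansion \<beta> s) \<longleftrightarrow> - of_real s \<in> G s"
proof -
  have s: "s \<in> {0..<1}" "s \<in> {0<..1}" "s \<in> K" using assms K_Rats by auto
  have tile: "- of_real s \<in> G s \<longleftrightarrow> 0 \<in> tile s"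
    using assms(1) by (simp add: tile_def sigma_Rats)
  show ?thesis unfolding purely_periodic_iff[OF s(1)]
  proof
    assume "\<exists>p>0. (T0 ^^ p) s = s"
    then obtain p where p: "p > 0" "(T0 ^^ p) s = s" by blast
    have nonzero: "(T0 ^^ n) s \<noteq> 0" for n
    proof
      assume "(T0 ^^ n) s = 0"
      moreover have "n \<le> p * n" using p(1) by simp
      ultimately have "(T0 ^^ (p * n)) s = 0" using T0_pow_0_mono by blast
      thus False using funpow_mult_fixed[OF p(2), of n] assms by simp
    qed
    have eq: "(T ^^ n) s = (T0 ^^ n) s" for n
    proof (induction n)
      case (Suc n)
      thus ?case using T_eq_T0[of "(T0 ^^ n) s"] nonzero[of "Suc n"] by simp
    qed simp
    have "(\<lambda>n. (\<alpha> ^ p) ^ n * of_real s - of_real s) \<longlonglongrightarrow> 0 * of_real s - of_real s"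
      using p(1) alpha_less_1
      by (intro tendsto_intros LIMSEQ_power_zero) (simp add: norm_power power_less_one_iff)
    moreover have "(\<alpha> ^ p) ^ n * of_real s - of_real s \<in> S s" for n
    proof -
      have "\<beta> ^ (p * n) * s - s \<in> B (p * n) s"
        unfolding int_parts_iff[OF s(2) beta_pos]
        by (intro bexI[of _ s] conjI s(2)) (simp_all add: eq funpow_mult_fixed[OF p(2)])
      moreover have "\<sigma> (\<beta> ^ (p * n) * s - s) = (\<alpha> ^ p) ^ n * of_real s - of_real s"
        using s(3) assms(1)
        by (simp add: sigma_diff sigma_mult K_mult K_power sigma_power sigma_Rats power_mult)
      ultimately show ?thesis unfolding S_def by (intro UN_I[OF UNIV_I] image_eqI) auto
    qed
    ultimately show "- of_real s \<in> G s"
      unfolding G_def closure_sequential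
      by (intro exI[of _ "\<lambda>n. (\<alpha> ^ p) ^ n * of_real s - of_real s"]) simp
  next
    assume "- of_real s \<in> G s"
    hence "0 \<in> tile s" using tile by simp
    then obtain m where m: "m > 0" "s \<in> P m" using Rats_in_P assms s(2) by blast
    obtain p where p: "p > 0" "(T ^^ p) s = s" using P_periodic[OF m] .
    have not_1: "(T ^^ n) s \<noteq> 1" for n
    proof
      assume 1: "(T ^^ n) s = 1"
      have "n \<le> p * n" using p(1) by simp
      hence "(T ^^ (p * n)) s = (T ^^ (p * n - n)) ((T ^^ n) s)"
        using funpow_add[of "p * n - n" n T] by simp
      hence "s = (T ^^ (p * n - n)) 1" using 1 funpow_mult_fixed[OF p(2), of n] by simp
      moreover have "(T ^^ (p * n - n)) 1 \<in> R" by (rule T_pow_in_R[OF R_1])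
      ultimately have "s \<in> R" by simp
      thus False using R_rat assms by force
    qed
    have eq: "(T ^^ n) s = (T0 ^^ n) s" for n
    proof (induction n)
      case (Suc n)
      thus ?case using T_eq_T0[of "(T ^^ n) s"] not_1[of "Suc n"] by simp
    qed simp
    show "\<exists>p>0. (T0 ^^ p) s = s" using p eq by auto
  qed
qed

definition periodic_at :: "real \<Rightarrow> bool" where
  "periodic_at s \<longleftrightarrow> purely_periodic (beta_expansion \<beta> s)"

lemma periodic_at_0: "periodic_at 0"
  by (auto simp: periodic_at_def purely_periodic_iff)

text \<open>Only base points to the left of \<open>r\<close> are compared with \<open>r\<close>, so
  \<open>r\<close> may itself be a threshold; this admits \<open>r = 1\<close>.\<close>

lemma rational_boundary_interior:
  assumes r: "r \<in> \<rat>" "0 < r" "r \<le> 1"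
    and below: "\<And>s. s \<in> \<rat> \<Longrightarrow> 0 < s \<Longrightarrow> s < r \<Longrightarrow> periodic_at s"
  obtains \<eta> where "\<eta> > 0" "ball (- of_real r) \<eta> \<subseteq> G r"
proof -
  obtain \<delta>0 where \<delta>0: "\<delta>0 > 0" "\<forall>g\<in>\<Theta>. g \<noteq> r \<longrightarrow> \<delta>0 \<le> dist r g"
    using finite_set_avoid[OF finite_Theta, of r] by blast
  \<comment> \<open>Half of the available length: a point \<open>r - t\<close> of the segment is
    approximated by rationals from below, which needs room beyond \<delta>.\<close>
  define \<delta> where "\<delta> = min \<delta>0 r / 2"
  have \<delta>: "\<delta> > 0" "2 * \<delta> \<le> \<delta>0" "2 * \<delta> \<le> r" using \<delta>0(1) r(2) by (auto simp: \<delta>_def)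
  have G: "- of_real s \<in> G r" if s: "s \<in> \<rat>" "r - 2 * \<delta> < s" "s < r" for s
  proof -
    have "S s = S r"
    proof (rule S_eqI)
      fix g assume "g \<in> \<Theta>" "s \<le> g" "g < r"
      hence "\<delta>0 \<le> r - g" using \<delta>0(2) by (force simp: dist_real_def)
      thus False using \<delta> s \<open>s \<le> g\<close> by simp
    qed (use s \<delta> r in auto)
    moreover have "0 < s" "s < 1" using s \<delta> r by auto
    ultimately show ?thesis
      using below[OF s(1) _ s(3)] purely_periodic_Rats_iff[OF s(1)] by (simp add: G_def periodic_at_def)
  qed
  have segment: "of_real t \<in> tile r" if t: "0 \<le> t" "t \<le> \<delta>" for t
  proof -
    have "- of_real (r - t) \<in> closure (G r)"
      unfolding closure_approachable
    proof (intro allI impI)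
      fix e :: real assume "e > 0"
      hence "max (r - t - e) (r - 2 * \<delta>) < r - t" using t \<delta> by auto
      then obtain s where s: "s \<in> \<rat>" "max (r - t - e) (r - 2 * \<delta>) < s" "s < r - t"
        using Rats_dense_in_real by blast
      hence "- of_real s \<in> G r" using G[of s] t by simp
      moreover have "dist (- of_real s) (- of_real (r - t) :: complex) < e"
        using s by (simp only: dist_minus dist_of_real) (simp add: dist_real_def)
      ultimately show "\<exists>y\<in>G r. dist y (- of_real (r - t)) < e" by blast
    qed
    hence "- of_real (r - t) \<in> G r" by (simp add: G_def)
    thus ?thesis using r(1) by (simp add: tile_def sigma_Rats)
  qed
  obtain m where "m > 0" "r \<in> P m"
    using Rats_in_P[of r] r segment[of 0] \<delta>(1) by auto
  then obtain \<eta> where \<eta>: "\<eta> > 0" "ball 0 \<eta> \<subseteq> tile r"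
    using spiral[OF _ _ \<delta>(1) segment] by blast
  have "ball (- of_real r) \<eta> \<subseteq> G r"
  proof
    fix z :: complex assume "z \<in> ball (- of_real r) \<eta>"
    hence "cmod (- (- of_real r - z)) < \<eta>" by (simp only: mem_ball dist_norm norm_minus_cancel)
    hence "z + of_real r \<in> ball 0 \<eta>" by (simp add: add.commute)
    hence "z + of_real r \<in> tile r" using \<eta> by blast
    thus "z \<in> G r" using r(1) by (simp add: tile_def sigma_Rats)
  qed
  thus ?thesis using that \<eta>(1) by blast
qed

lemma gamma_beta_irrational:
  "gamma_beta \<beta> \<notin> \<rat> \<and> 0 < gamma_beta \<beta> \<and> gamma_beta \<beta> < 1"
proof -
  define A where "A = {c \<in> {0..<1}. \<forall>r\<in>\<rat>. 0 \<le> r \<and> r \<le> c \<longrightarrow> periodic_at r}"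
  define \<gamma> where "\<gamma> = gamma_beta \<beta>"
  have \<gamma>: "\<gamma> = Sup A" by (simp add: \<gamma>_def A_def gamma_beta_def periodic_at_def)
  have bdd: "bdd_above A" by (auto simp: A_def intro: bdd_aboveI[of _ 1])
  have "0 \<in> A" using periodic_at_0 by (auto simp: A_def)
  have le_1: "\<gamma> \<le> 1" unfolding \<gamma> using \<open>0 \<in> A\<close> by (intro cSup_least) (blast, auto simp: A_def)
  have below: "periodic_at s" if s: "s \<in> \<rat>" "0 < s" "s < \<gamma>" for s
  proof -
    obtain c where "c \<in> A" "s < c"
      using s(3) less_cSup_iff[OF _ bdd] \<open>0 \<in> A\<close> unfolding \<gamma> by blast
    thus ?thesis using s by (auto simp: A_def)
  qed
  obtain \<delta> where \<delta>: "\<delta> > 0" "\<delta> \<le> 1" "\<And>s. 0 < s \<Longrightarrow> s < \<delta> \<Longrightarrow> - of_real s \<in> G s"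
    using G_near_0 by blast
  have "periodic_at s" if "s \<in> \<rat>" "0 \<le> s" "s \<le> \<delta> / 2" for s
    using that \<delta> purely_periodic_Rats_iff[of s] periodic_at_0 by (cases "s = 0") (auto simp: periodic_at_def)
  hence "\<delta> / 2 \<in> A" using \<delta> by (auto simp: A_def)
  hence "\<delta> / 2 \<le> \<gamma>" unfolding \<gamma> using bdd by (rule cSup_upper)
  hence pos: "\<gamma> > 0" using \<delta>(1) by simp
  have irr: "\<gamma> \<notin> \<rat>"
  proof
    assume rat: "\<gamma> \<in> \<rat>"
    obtain \<eta> where \<eta>: "\<eta> > 0" "ball (- of_real \<gamma>) \<eta> \<subseteq> G \<gamma>"
      using rational_boundary_interior[OF rat pos le_1 below] by blast
    have "\<gamma> \<noteq> 1" using minus_1_not_interior_G_1 \<eta> by fastforce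
    hence "\<gamma> < 1" using le_1 by simp
    obtain \<delta>0 where \<delta>0: "\<delta>0 > 0" "\<forall>g\<in>\<Theta>. g \<noteq> \<gamma> \<longrightarrow> \<delta>0 \<le> dist \<gamma> g"
      using finite_set_avoid[OF finite_Theta, of \<gamma>] by blast
    \<comment> \<open>To the right of \<gamma> the interval to be free of thresholds includes
      \<gamma> itself, but positive rationals in \<open>R\<close> are at least 1.\<close>
    have "\<gamma> \<notin> \<Theta>" using R_rat[OF rat _ pos] \<open>\<gamma> < 1\<close> by (auto simp: \<Theta>_def)
    define c where "c = (\<gamma> + min (min (\<gamma> + \<eta>) (\<gamma> + \<delta>0)) 1) / 2"
    have c: "\<gamma> < c" "c < \<gamma> + \<eta>" "c < \<gamma> + \<delta>0" "c < 1"
      using \<eta>(1) \<delta>0(1) \<open>\<gamma> < 1\<close> by (auto simp: c_def min_def)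
    have "periodic_at s" if s: "s \<in> \<rat>" "0 \<le> s" "s \<le> c" for s
    proof (cases "s < \<gamma>")
      case True
      thus ?thesis using below s periodic_at_0 by (cases "s = 0") auto
    next
      case False
      have "S \<gamma> = S s"
      proof (rule S_eqI)
        fix g assume g: "g \<in> \<Theta>" "\<gamma> \<le> g" "g < s"
        hence "\<delta>0 \<le> g - \<gamma>" using \<delta>0(2) \<open>\<gamma> \<notin> \<Theta>\<close> by (force simp: dist_real_def)
        thus False using g s c by simp
      qed (use False s c pos \<open>\<gamma> < 1\<close> in auto)
      moreover have "- of_real s \<in> ball (- of_real \<gamma> :: complex) \<eta>"
        using False s c by (simp only: mem_ball dist_minus dist_of_real) (simp add: dist_real_def)
      ultimately have "- of_real s \<in> G s" using \<eta>(2) by (auto simp: G_def)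
      thus ?thesis using purely_periodic_Rats_iff[OF s(1)] False pos s c by (simp add: periodic_at_def)
    qed
    hence "c \<in> A" using c pos by (auto simp: A_def)
    hence "c \<le> \<gamma>" unfolding \<gamma> using bdd by (rule cSup_upper)
    thus False using c by simp
  qed
  have "\<gamma> \<noteq> 1" using irr by auto
  thus ?thesis using irr pos le_1 by (simp add: \<gamma>_def)
qed

end

section \<open>Arithmetic of cubic fields\<close>

lemma poly_map_poly_add:
  assumes "f 0 = 0" "\<And>a b. f (a + b) = f a + f b"
  shows "poly (map_poly f (p + q)) x = poly (map_poly f p) x + poly (map_poly f q) x"
  by (induction p q rule: poly_induct2) (simp_all add: map_poly_pCons assms algebra_simps)

lemma poly_map_poly_smult:
  assumes "f 0 = 0" "\<And>a b. f (a * b) = f a * f b"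
  shows "poly (map_poly f (smult c p)) x = f c * poly (map_poly f p) x"
  by (simp add: map_poly_smult assms)

lemma poly_map_poly_mult:
  fixes f :: "'a::comm_ring_1 \<Rightarrow> 'b::comm_ring_1"
  assumes "f 0 = 0" "\<And>a b. f (a + b) = f a + f b" "\<And>a b. f (a * b) = f a * f b"
  shows "poly (map_poly f (p * q)) x = poly (map_poly f p) x * poly (map_poly f q) x"
  by (induction p)
     (simp_all add: map_poly_pCons poly_map_poly_add poly_map_poly_smult assms algebra_simps)

abbreviation rpoly :: "rat poly \<Rightarrow> 'a::field_char_0 \<Rightarrow> 'a" where
  "rpoly p x \<equiv> poly (map_poly of_rat p) x"

lemma rpoly_add: "rpoly (p + q) x = rpoly p x + rpoly q x"
  by (rule poly_map_poly_add) (auto simp: of_rat_add)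

lemma rpoly_mult: "rpoly (p * q) x = rpoly p x * rpoly q x"
  by (rule poly_map_poly_mult) (auto simp: of_rat_add of_rat_mult)

lemma rpoly_smult: "rpoly (smult c p) x = of_rat c * rpoly p x"
  by (rule poly_map_poly_smult) (auto simp: of_rat_mult)

lemma rpoly_pCons: "rpoly (pCons c p) x = of_rat c + x * rpoly p x"
  by (simp add: map_poly_pCons)

text \<open>The definite description is realised by a monic polynomial of least degree vanishing at
  \<open>x\<close>: division with remainder gives divisibility, and a factor vanishing at
  \<open>x\<close> already has full degree.\<close>

lemma min_rat_poly:
  fixes x :: "'a::field_char_0"
  assumes "algebraic_int x"
  shows "lead_coeff (min_rat_poly x) = 1"
    and "rpoly (min_rat_poly x) x = 0"
    and "rpoly p x = 0 \<Longrightarrow> min_rat_poly x dvd p"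
proof -
  obtain q :: "int poly" where q: "poly (map_poly of_int q) x = 0" "lead_coeff q = 1"
    using assms algebraic_int_altdef_ipoly by blast
  have "map_poly of_rat (map_poly of_int q :: rat poly) = (map_poly of_int q :: 'a poly)"
    by (subst map_poly_map_poly) (auto simp: o_def)
  hence "rpoly (map_poly of_int q) x = 0" using q by simp
  moreover have "q \<noteq> 0" using q(2) by auto
  hence "map_poly of_int q \<noteq> (0 :: rat poly)" by (simp add: map_poly_eq_0_iff)
  ultimately obtain \<mu>0 :: "rat poly" where \<mu>0: "\<mu>0 \<noteq> 0" "rpoly \<mu>0 x = 0"
    "\<And>p. p \<noteq> 0 \<Longrightarrow> rpoly p x = 0 \<Longrightarrow> degree \<mu>0 \<le> degree p"
    using ex_has_least_nat[of "\<lambda>p. p \<noteq> 0 \<and> rpoly p x = 0" _ degree] by metis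
  define \<mu> where "\<mu> = smult (inverse (lead_coeff \<mu>0)) \<mu>0"
  have \<mu>: "lead_coeff \<mu> = 1" "rpoly \<mu> x = 0"
    and least: "\<And>p. p \<noteq> 0 \<Longrightarrow> rpoly p x = 0 \<Longrightarrow> degree \<mu> \<le> degree p"
    using \<mu>0 by (simp_all add: \<mu>_def rpoly_smult)
  have "\<mu> \<noteq> 0" using \<mu>(1) by auto
  have dvd: "\<mu> dvd p" if "rpoly p x = 0" for p
  proof (rule ccontr)
    assume "\<not> \<mu> dvd p"
    hence nz: "p mod \<mu> \<noteq> 0" by (simp add: mod_eq_0_iff_dvd)
    have "rpoly (p div \<mu> * \<mu> + p mod \<mu>) x = 0" using that by simp
    hence "rpoly (p mod \<mu>) x = 0" using \<mu>(2) by (simp only: rpoly_add rpoly_mult) simp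
    hence "degree \<mu> \<le> degree (p mod \<mu>)" using least nz by blast
    thus False using degree_mod_less[of \<mu> p] \<open>\<mu> \<noteq> 0\<close> nz by auto
  qed
  have not_unit: "\<not> \<mu> dvd 1"
  proof
    assume "\<mu> dvd 1"
    then obtain c where c: "\<mu> = [:c:]" by (rule is_unit_polyE)
    thus False using \<mu> by (simp add: map_poly_pCons)
  qed
  have irred: "irreducible \<mu>"
  proof (rule irreducibleI)
    fix a b assume ab: "\<mu> = a * b"
    have aux: "d dvd 1" if "\<mu> = c * d" "rpoly c x = 0" for c d
    proof -
      have "c \<noteq> 0" "d \<noteq> 0" using that(1) \<open>\<mu> \<noteq> 0\<close> by auto
      moreover from this have "degree \<mu> = degree c + degree d" by (simp add: that(1) degree_mult_eq)
      ultimately have "degree d = 0" using least[of c] that(2) by simp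
      thus ?thesis using \<open>d \<noteq> 0\<close> is_unit_iff_degree by blast
    qed
    have "rpoly a x = 0 \<or> rpoly b x = 0" using \<mu>(2) unfolding ab by (simp add: rpoly_mult)
    thus "a dvd 1 \<or> b dvd 1" using aux[of a b] aux[of b a] ab by (auto simp: mult.commute)
  qed (use not_unit \<open>\<mu> \<noteq> 0\<close> in auto)
  have "min_rat_poly x = \<mu>"
    unfolding min_rat_poly_def
  proof (rule the_equality)
    fix p :: "rat poly"
    assume p: "lead_coeff p = 1 \<and> irreducible p \<and> rpoly p x = 0"
    then obtain k where k: "p = \<mu> * k" using dvd by (blast elim: dvdE)
    hence "k dvd 1" using p irreducibleD not_unit by blast
    then obtain c where "k = [:c:]" by (rule is_unit_polyE)
    moreover have "lead_coeff k = 1" using p \<mu>(1) unfolding k lead_coeff_mult by simp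
    ultimately show "p = \<mu>" using k by simp
  qed (use \<mu> irred in auto)
  thus "lead_coeff (min_rat_poly x) = 1" "rpoly (min_rat_poly x) x = 0"
    "rpoly p x = 0 \<Longrightarrow> min_rat_poly x dvd p"
    using \<mu> dvd by auto
qed

section \<open>The ring generated by one real number\<close>

lemma int_adjoin_iff: "y \<in> int_adjoin x \<longleftrightarrow> (\<exists>p::int poly. y = poly (map_poly of_int p) x)"
  by (auto simp: int_adjoin_def)

lemma int_adjoin_of_int [simp]: "of_int a \<in> int_adjoin x"
  unfolding int_adjoin_iff by (rule exI[of _ "[:a:]"]) (simp add: map_poly_pCons)

lemma int_adjoin_self [simp]: "x \<in> int_adjoin x"
  unfolding int_adjoin_iff by (rule exI[of _ "[:0, 1:]"]) (simp add: map_poly_pCons)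

lemma int_adjoin_add:
  assumes "y \<in> int_adjoin x" "z \<in> int_adjoin x"
  shows "y + z \<in> int_adjoin x"
proof -
  obtain p q :: "int poly" where "y = poly (map_poly of_int p) x" "z = poly (map_poly of_int q) x"
    using assms by (auto simp: int_adjoin_iff)
  hence "y + z = poly (map_poly of_int (p + q)) x" by (simp add: poly_map_poly_add)
  thus ?thesis by (auto simp: int_adjoin_iff)
qed

lemma int_adjoin_mult:
  assumes "y \<in> int_adjoin x" "z \<in> int_adjoin x"
  shows "y * z \<in> int_adjoin x"
proof -
  obtain p q :: "int poly" where "y = poly (map_poly of_int p) x" "z = poly (map_poly of_int q) x"
    using assms by (auto simp: int_adjoin_iff)
  hence "y * z = poly (map_poly of_int (p * q)) x" by (simp add: poly_map_poly_mult)
  thus ?thesis by (auto simp: int_adjoin_iff)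
qed

lemma int_adjoin_uminus: "y \<in> int_adjoin x \<Longrightarrow> - y \<in> int_adjoin x"
  using int_adjoin_mult[OF int_adjoin_of_int[of "-1" x], of y] by simp

lemma int_adjoin_power:
  assumes "y \<in> int_adjoin x"
  shows "y ^ n \<in> int_adjoin x"
proof (induction n)
  case 0
  show ?case using int_adjoin_of_int[of 1 x] by simp
next
  case (Suc n)
  show ?case using int_adjoin_mult[OF assms Suc] by simp
qed

lemma int_adjoin_sum:
  assumes "\<And>i. i \<in> I \<Longrightarrow> f i \<in> int_adjoin x"
  shows "sum f I \<in> int_adjoin x"
  using assms int_adjoin_of_int[of 0 x]
  by (induction I rule: infinite_finite_induct) (simp_all add: int_adjoin_add)

lemma int_adjoin_subset:
  assumes "y \<in> int_adjoin x"
  shows "int_adjoin y \<subseteq> int_adjoin x"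
proof
  fix z assume "z \<in> int_adjoin y"
  then obtain p :: "int poly" where "z = poly (map_poly of_int p) y"
    by (auto simp: int_adjoin_iff)
  hence "z = (\<Sum>i\<le>degree (map_poly of_int p :: real poly). of_int (coeff p i) * y ^ i)"
    by (simp add: poly_altdef coeff_map_poly)
  also have "\<dots> \<in> int_adjoin x"
    by (intro int_adjoin_sum int_adjoin_mult int_adjoin_of_int int_adjoin_power assms)
  finally show "z \<in> int_adjoin x" .
qed

lemma algebraic_int_power_eq:
  fixes x :: real
  assumes "algebraic_int x"
  obtains n :: nat and c :: "nat \<Rightarrow> int"
  where "n > 0" "x ^ n = (\<Sum>i<n. of_int (c i) * x ^ i)"
proof -
  obtain q :: "int poly" where q: "poly (map_poly of_int q) x = 0" "lead_coeff q = 1"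
    using assms algebraic_int_altdef_ipoly by blast
  define n where "n = degree q"
  have "n > 0"
  proof (rule ccontr)
    assume "\<not> n > 0"
    then obtain a where "q = [:a:]" by (auto simp: n_def elim: degree_eq_zeroE)
    thus False using q by (simp add: map_poly_pCons)
  qed
  have "0 = (\<Sum>i\<le>n. of_int (coeff q i) * x ^ i)"
    using q(1) by (simp add: poly_altdef coeff_map_poly degree_map_poly n_def)
  also have "\<dots> = (\<Sum>i<n. of_int (coeff q i) * x ^ i) + x ^ n"
    using q(2) by (simp add: n_def flip: lessThan_Suc_atMost)
  finally have "x ^ n = (\<Sum>i<n. of_int (- coeff q i) * x ^ i)"
    by (simp add: sum_negf)
  thus ?thesis by (rule that[OF \<open>n > 0\<close>])
qed

text \<open>Multiplying a monic relation of degree n for y by x^(n-1) leaves y as an integer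
  combination of powers of x. It serves both for 1 / \<beta> in Z[\<beta>] and for \<beta> in
  Z[1/\<beta>].\<close>

lemma algebraic_int_in_adjoin_inverse:
  fixes x y :: real
  assumes "algebraic_int y" "x * y = 1"
  shows "y \<in> int_adjoin x"
proof -
  obtain n and c :: "nat \<Rightarrow> int" where n: "n > 0" "y ^ n = (\<Sum>i<n. of_int (c i) * y ^ i)"
    using algebraic_int_power_eq[OF assms(1)] .
  have xy: "x ^ k * y ^ i = x ^ (k - i)" if "i \<le> k" for i k
  proof -
    have "x ^ k * y ^ i = x ^ (k - i) * (x * y) ^ i"
      using that by (simp add: power_mult_distrib mult.assoc flip: power_add)
    thus ?thesis by (simp add: assms(2))
  qed
  have "y = y * (x * y) ^ (n - 1)" by (simp add: assms(2))
  also have "\<dots> = x ^ (n - 1) * y ^ n"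
    using n(1) by (cases n) (simp_all add: power_mult_distrib)
  also have "\<dots> = (\<Sum>i<n. of_int (c i) * (x ^ (n - 1) * y ^ i))"
    by (simp add: n(2) sum_distrib_left mult_ac)
  also have "\<dots> = (\<Sum>i<n. of_int (c i) * x ^ (n - 1 - i))"
    by (intro sum.cong refl arg_cong2[where f = "(*)"] xy) auto
  finally have eq: "y = (\<Sum>i<n. of_int (c i) * x ^ (n - 1 - i))" .
  show ?thesis
    by (subst eq) (intro int_adjoin_sum int_adjoin_mult int_adjoin_power int_adjoin_of_int int_adjoin_self)
qed

lemma is_subfield_rat_adjoin: "is_subfield (rat_adjoin x)"
  unfolding rat_adjoin_def by (rule hull_in) (auto simp: is_subfield_def)

lemma self_in_rat_adjoin: "x \<in> rat_adjoin x"
  unfolding rat_adjoin_def by (rule hull_inc) auto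

text \<open>Beyond the last non-zero digit the map is plain multiplication by \<beta>; an orbit that
  stays below 1 must then be 0.\<close>

lemma property_F_finite_orbit:
  assumes "property_F \<beta>" "\<beta> > 1" "x \<in> int_adjoin (1 / \<beta>)" "0 \<le> x" "x < 1"
  shows "\<exists>n. (beta_transformation \<beta> ^^ n) x = 0"
proof -
  have "finite {n. n \<ge> 1 \<and> beta_expansion \<beta> x n \<noteq> 0}"
    using assms by (auto simp: property_F_def)
  then obtain m where m: "\<And>n. n \<ge> 1 \<Longrightarrow> beta_expansion \<beta> x n \<noteq> 0 \<Longrightarrow> n \<le> m"
    by (auto simp: finite_nat_set_iff_bounded_le)
  define y where "y = (beta_transformation \<beta> ^^ m) x"
  have y: "0 \<le> y" "y < 1"
  proof -
    have "y \<in> {0..<1}"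
    proof (cases m)
      case (Suc k)
      thus ?thesis unfolding y_def by (simp add: beta_transformation_def; linarith)
    qed (use assms in \<open>simp add: y_def\<close>)
    thus "0 \<le> y" "y < 1" by auto
  qed
  have scale: "(beta_transformation \<beta> ^^ k) y = \<beta> ^ k * y" for k
  proof (induction k)
    case (Suc k)
    have "beta_expansion \<beta> x (Suc (k + m)) = 0"
      using m[of "Suc (k + m)"] by auto
    hence "\<lfloor>\<beta> * (beta_transformation \<beta> ^^ k) y\<rfloor> = 0"
      by (simp add: beta_expansion_def y_def funpow_add)
    hence "beta_transformation \<beta> (\<beta> ^ k * y) = \<beta> * (\<beta> ^ k * y)"
      by (simp add: beta_transformation_def Suc)
    thus ?case by (simp add: Suc mult.assoc)
  qed simp
  have bounded: "\<beta> ^ k * y < 1" for k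
  proof (cases k)
    case (Suc j)
    show ?thesis
      unfolding scale[symmetric] Suc by (simp add: beta_transformation_def; linarith)
  qed (use y in simp)
  have "y = 0"
  proof (rule ccontr)
    assume "y \<noteq> 0"
    obtain k where "1 / y < \<beta> ^ k" using real_arch_pow[OF assms(2)] by blast
    thus False using bounded[of k] y \<open>y \<noteq> 0\<close> by (simp add: divide_less_eq)
  qed
  thus ?thesis unfolding y_def by blast
qed

lemma finite_int_abs_le: "finite {a::int. \<bar>of_int a :: real\<bar> \<le> M}"
proof (rule finite_subset)
  show "{a::int. \<bar>of_int a :: real\<bar> \<le> M} \<subseteq> {- \<lceil>M\<rceil>..\<lceil>M\<rceil>}"
    by (auto simp: abs_le_iff ceiling_le_iff le_ceiling_iff; linarith)
qed simp

lemma Rats_denominator: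
  fixes x :: real
  assumes "x \<in> \<rat>"
  obtains d :: nat where "d > 0" "of_nat d * x \<in> \<int>"
proof -
  obtain a b :: int where "b > 0" "x = of_int a / of_int b"
    using assms by (elim Rats_cases') auto
  hence "nat b > 0" "of_nat (nat b) * x \<in> \<int>" by auto
  thus ?thesis by (rule that)
qed

lemma (in subfield_embedding) sigma_rpoly:
  assumes "x \<in> K"
  shows "rpoly p x \<in> K" "\<sigma> (rpoly p x) = rpoly p (\<sigma> x)"
proof -
  have "rpoly p x \<in> K \<and> \<sigma> (rpoly p x) = rpoly p (\<sigma> x)"
  proof (induction p)
    case (pCons c p)
    have "real_of_rat c \<in> \<rat>" by simp
    moreover have "\<sigma> (real_of_rat c) = of_rat c"
    proof (cases c)
      case (Fract a b)
      thus ?thesis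
        using sigma_divide[of "of_int a" "of_int b"] by (simp add: of_rat_rat)
    qed
    ultimately show ?case
      using pCons assms by (simp add: rpoly_pCons K_Rats K_add K_mult sigma_add sigma_mult)
  qed simp
  thus "rpoly p x \<in> K" "\<sigma> (rpoly p x) = rpoly p (\<sigma> x)" by auto
qed

lemma (in subfield_embedding) sigma_eq_0D:
  assumes "x \<in> K" "\<sigma> x = 0"
  shows "x = 0"
proof (rule ccontr)
  assume "x \<noteq> 0"
  hence "1 = \<sigma> (x * inverse x)" by simp
  also have "\<dots> = 0" using assms by (simp add: sigma_mult K_inverse)
  finally show False by simp
qed

section \<open>Cubic numbers with a non-real conjugate\<close>

locale cubic_embedding = subfield_embedding +
  fixes \<beta> :: real
  assumes beta_in_K: "\<beta> \<in> K"
    and algebraic_int_beta: "algebraic_int \<beta>"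
    and independent: "\<And>a b c. a \<in> \<rat> \<Longrightarrow> b \<in> \<rat> \<Longrightarrow> c \<in> \<rat> \<Longrightarrow> a + b * \<beta> + c * \<beta> ^ 2 = 0 \<Longrightarrow>
                          a = 0 \<and> b = 0 \<and> c = 0"
    and cubic: "\<exists>a\<in>\<rat>. \<exists>b\<in>\<rat>. \<exists>c\<in>\<rat>. \<beta> ^ 3 = a + b * \<beta> + c * \<beta> ^ 2"
    and sigma_nonreal: "\<sigma> \<beta> \<notin> \<real>"
    and beta_gt_1: "\<beta> > 1"
    and sigma_less_1: "cmod (\<sigma> \<beta>) < 1"
begin

lemma power_span: "\<exists>a\<in>\<rat>. \<exists>b\<in>\<rat>. \<exists>c\<in>\<rat>. \<beta> ^ n = a + b * \<beta> + c * \<beta> ^ 2"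
proof (induction n)
  case 0
  show ?case by (intro bexI[of _ 1] bexI[of _ 0]) auto
next
  case (Suc n)
  then obtain a b c where abc: "a \<in> \<rat>" "b \<in> \<rat>" "c \<in> \<rat>" "\<beta> ^ n = a + b * \<beta> + c * \<beta> ^ 2"
    by blast
  obtain a' b' c' where abc': "a' \<in> \<rat>" "b' \<in> \<rat>" "c' \<in> \<rat>" "\<beta> ^ 3 = a' + b' * \<beta> + c' * \<beta> ^ 2"
    using cubic by blast
  have "\<beta> ^ Suc n = \<beta> * (a + b * \<beta> + c * \<beta> ^ 2)" using abc(4) by simp
  also have "\<dots> = a * \<beta> + b * \<beta> ^ 2 + c * \<beta> ^ 3"
    by (simp add: algebra_simps power2_eq_square power3_eq_cube)
  also have "\<dots> = c * a' + (a + c * b') * \<beta> + (b + c * c') * \<beta> ^ 2"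
    by (simp add: abc'(4) algebra_simps)
  finally show ?case
    using abc(1-3) abc'(1-3)
    by (rule_tac bexI[of _ "c * a'"], rule_tac bexI[of _ "a + c * b'"], rule_tac bexI[of _ "b + c * c'"])
       simp_all
qed

lemma sigma_combination:
  assumes "a \<in> \<rat>" "b \<in> \<rat>" "c \<in> \<rat>"
  shows "a + b * \<beta> + c * \<beta> ^ 2 \<in> K"
    and "\<sigma> (a + b * \<beta> + c * \<beta> ^ 2) = of_real a + of_real b * \<sigma> \<beta> + of_real c * \<sigma> \<beta> ^ 2"
  using assms beta_in_K
  by (simp_all add: K_Rats K_add K_mult K_power sigma_add sigma_mult sigma_power sigma_Rats)

lemma sigma_independent:
  assumes "a \<in> \<rat>" "b \<in> \<rat>" "c \<in> \<rat>" "of_real a + of_real b * \<sigma> \<beta> + of_real c * \<sigma> \<beta> ^ 2 = 0"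
  shows "a = 0 \<and> b = 0 \<and> c = 0"
  using sigma_eq_0D[OF sigma_combination(1)[OF assms(1-3)]] sigma_combination(2)[OF assms(1-3)]
    independent[OF assms(1-3)] assms(4) by metis

text \<open>Write \<beta>^n = a + b \<beta> + c \<beta>^2. If c = 0, a real \<alpha>^n forces b = 0
  and hence \<alpha>^n = \<beta>^n, against the moduli. Otherwise the real part of \<alpha> is
  rational, the imaginary part of the cubic relation makes v^2 rational as well, and \<alpha>
  satisfies a rational quadratic equation.\<close>

lemma power_nonreal:
  assumes "n > 0"
  shows "\<sigma> \<beta> ^ n \<notin> \<real>"
proof
  assume real: "\<sigma> \<beta> ^ n \<in> \<real>"
  define u v where "u = Re (\<sigma> \<beta>)" and "v = Im (\<sigma> \<beta>)"
  have "v \<noteq> 0" using sigma_nonreal by (simp add: complex_is_Real_iff v_def)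
  have Im_sq: "Im (\<sigma> \<beta> ^ 2) = 2 * u * v" and Re_sq: "Re (\<sigma> \<beta> ^ 2) = u ^ 2 - v ^ 2"
    by (simp_all add: power2_eq_square u_def v_def)
  obtain a b c where abc: "a \<in> \<rat>" "b \<in> \<rat>" "c \<in> \<rat>" "\<beta> ^ n = a + b * \<beta> + c * \<beta> ^ 2"
    using power_span by blast
  have eq: "\<sigma> \<beta> ^ n = of_real a + of_real b * \<sigma> \<beta> + of_real c * \<sigma> \<beta> ^ 2"
    using sigma_combination(2)[OF abc(1-3)] sigma_power[OF beta_in_K, of n] abc(4) by simp
  have "Im (\<sigma> \<beta> ^ n) = (b + 2 * c * u) * v"
    unfolding eq by (simp add: Im_sq algebra_simps flip: v_def)
  hence bcu: "b + 2 * c * u = 0"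
    using real \<open>v \<noteq> 0\<close> by (simp add: complex_is_Real_iff)
  show False
  proof (cases "c = 0")
    case True
    hence "\<sigma> \<beta> ^ n = of_real (\<beta> ^ n)" using bcu eq abc(4) by simp
    hence "cmod (\<sigma> \<beta> ^ n) = \<bar>\<beta> ^ n\<bar>" by (simp only: norm_of_real)
    hence "cmod (\<sigma> \<beta>) ^ n = \<beta> ^ n" using beta_gt_1 by (simp add: norm_power)
    moreover have "cmod (\<sigma> \<beta>) ^ n < 1" using sigma_less_1 assms by (simp add: power_less_one_iff)
    moreover have "1 < \<beta> ^ n" using beta_gt_1 assms by (simp add: one_less_power)
    ultimately show False by simp
  next
    case False
    hence "u = - b / (2 * c)" using bcu by (simp add: field_simps)
    hence u: "u \<in> \<rat>" using abc by simp
    obtain a' b' c' where abc': "a' \<in> \<rat>" "b' \<in> \<rat>" "c' \<in> \<rat>" "\<beta> ^ 3 = a' + b' * \<beta> + c' * \<beta> ^ 2"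
      using cubic by blast
    have eq': "\<sigma> \<beta> ^ 3 = of_real a' + of_real b' * \<sigma> \<beta> + of_real c' * \<sigma> \<beta> ^ 2"
      using sigma_combination(2)[OF abc'(1-3)] sigma_power[OF beta_in_K, of 3] abc'(4) by simp
    have "Im (\<sigma> \<beta> ^ 3) = (3 * u ^ 2 - v ^ 2) * v"
      by (simp add: power3_eq_cube power2_eq_square u_def v_def algebra_simps)
    moreover have "Im (\<sigma> \<beta> ^ 3) = (b' + 2 * c' * u) * v"
      unfolding eq' by (simp add: Im_sq algebra_simps flip: v_def)
    ultimately have "3 * u ^ 2 - v ^ 2 = b' + 2 * c' * u" using \<open>v \<noteq> 0\<close> by simp
    hence "v ^ 2 = 3 * u ^ 2 - b' - 2 * c' * u" by simp
    hence "v ^ 2 \<in> \<rat>" using u abc' by simp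
    hence N: "u ^ 2 + v ^ 2 \<in> \<rat>" using u by simp
    have "of_real (u ^ 2 + v ^ 2) + of_real (- 2 * u) * \<sigma> \<beta> + of_real 1 * \<sigma> \<beta> ^ 2 = 0"
      by (simp add: complex_eq_iff Im_sq Re_sq power2_eq_square flip: u_def v_def)
    thus False using sigma_independent[OF N, of "- 2 * u" 1] u by simp
  qed
qed

text \<open>Working with a common denominator avoids proving that the minimal polynomial has integer
  coefficients.\<close>

definition \<Lambda> :: "real set" where
  "\<Lambda> = {x. \<exists>a b c :: int. x = of_int a + of_int b * \<beta> + of_int c * \<beta> ^ 2}"

lemma Lambda_add:
  assumes "x \<in> \<Lambda>" "y \<in> \<Lambda>"
  shows "x + y \<in> \<Lambda>"
proof -
  obtain a b c a' b' c' :: int where "x = of_int a + of_int b * \<beta> + of_int c * \<beta> ^ 2"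
    "y = of_int a' + of_int b' * \<beta> + of_int c' * \<beta> ^ 2"
    using assms by (auto simp: \<Lambda>_def)
  hence "x + y = of_int (a + a') + of_int (b + b') * \<beta> + of_int (c + c') * \<beta> ^ 2"
    by (simp add: algebra_simps)
  thus ?thesis unfolding \<Lambda>_def by blast
qed

lemma Lambda_mult_int:
  assumes "x \<in> \<Lambda>"
  shows "of_int k * x \<in> \<Lambda>"
proof -
  obtain a b c :: int where "x = of_int a + of_int b * \<beta> + of_int c * \<beta> ^ 2"
    using assms by (auto simp: \<Lambda>_def)
  hence "of_int k * x = of_int (k * a) + of_int (k * b) * \<beta> + of_int (k * c) * \<beta> ^ 2"
    by (simp add: algebra_simps)
  thus ?thesis unfolding \<Lambda>_def by blast
qed

lemma Lambda_0: "0 \<in> \<Lambda>"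
  unfolding \<Lambda>_def by (auto intro!: exI[of _ 0])

lemma Lambda_sum: "(\<And>i. i \<in> I \<Longrightarrow> f i \<in> \<Lambda>) \<Longrightarrow> sum f I \<in> \<Lambda>"
  by (induction I rule: infinite_finite_induct) (simp_all add: Lambda_0 Lambda_add)

lemma common_denominator_powers: "\<exists>d::nat. d > 0 \<and> (\<forall>i<n. of_nat d * \<beta> ^ i \<in> \<Lambda>)"
proof (induction n)
  case 0
  show ?case by (intro exI[of _ 1]) simp
next
  case (Suc n)
  then obtain d :: nat where d: "d > 0" "\<And>i. i < n \<Longrightarrow> of_nat d * \<beta> ^ i \<in> \<Lambda>" by blast
  obtain a b c where abc: "a \<in> \<rat>" "b \<in> \<rat>" "c \<in> \<rat>" "\<beta> ^ n = a + b * \<beta> + c * \<beta> ^ 2"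
    using power_span by blast
  obtain e1 where e1: "e1 > 0" "of_nat e1 * a \<in> \<int>" using Rats_denominator[OF abc(1)] .
  obtain e2 where e2: "e2 > 0" "of_nat e2 * b \<in> \<int>" using Rats_denominator[OF abc(2)] .
  obtain e3 where e3: "e3 > 0" "of_nat e3 * c \<in> \<int>" using Rats_denominator[OF abc(3)] .
  define e where "e = e1 * e2 * e3"
  have "e > 0" using e1 e2 e3 by (simp add: e_def)
  have "of_nat e * a = of_nat (e2 * e3) * (of_nat e1 * a)"
    "of_nat e * b = of_nat (e1 * e3) * (of_nat e2 * b)"
    "of_nat e * c = of_nat (e1 * e2) * (of_nat e3 * c)"
    by (simp_all add: e_def)
  hence "of_nat e * a \<in> \<int>" "of_nat e * b \<in> \<int>" "of_nat e * c \<in> \<int>"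
    using e1(2) e2(2) e3(2) by (metis Ints_mult Ints_of_nat)+
  then obtain a' b' c' :: int where
    "of_nat e * a = of_int a'" "of_nat e * b = of_int b'" "of_nat e * c = of_int c'"
    by (auto elim!: Ints_cases)
  hence "of_nat e * \<beta> ^ n = of_int a' + of_int b' * \<beta> + of_int c' * \<beta> ^ 2"
    unfolding abc(4) by (simp only: distrib_left mult.assoc[symmetric])
  hence en: "of_nat e * \<beta> ^ n \<in> \<Lambda>" unfolding \<Lambda>_def by blast
  have "of_nat (d * e) * \<beta> ^ i \<in> \<Lambda>" if "i < Suc n" for i
  proof (cases "i = n")
    case True
    thus ?thesis using Lambda_mult_int[OF en, of "int d"] by (simp add: mult_ac)
  next
    case False
    hence "of_nat d * \<beta> ^ i \<in> \<Lambda>" using d(2) that by simp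
    thus ?thesis using Lambda_mult_int[of _ "int e"] by (fastforce simp: mult_ac)
  qed
  thus ?case using d(1) \<open>e > 0\<close> by (intro exI[of _ "d * e"]) auto
qed

text \<open>A monic relation reduces high powers with integer coefficients, so a denominator for the
  powers below its degree serves them all.\<close>

lemma common_denominator:
  obtains d :: nat where "d > 0" "\<And>x. x \<in> int_adjoin \<beta> \<Longrightarrow> of_nat d * x \<in> \<Lambda>"
proof -
  obtain n and c :: "nat \<Rightarrow> int" where n: "\<beta> ^ n = (\<Sum>i<n. of_int (c i) * \<beta> ^ i)"
    using algebraic_int_power_eq[OF algebraic_int_beta] by metis
  obtain d :: nat where d: "d > 0" "\<And>i. i < n \<Longrightarrow> of_nat d * \<beta> ^ i \<in> \<Lambda>"
    using common_denominator_powers by blast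
  have pow: "of_nat d * \<beta> ^ i \<in> \<Lambda>" for i
  proof (induction i rule: less_induct)
    case (less i)
    show ?case
    proof (cases "i < n")
      case False
      hence "\<beta> ^ i = \<beta> ^ (i - n) * \<beta> ^ n" by (simp flip: power_add)
      also have "\<dots> = (\<Sum>j<n. of_int (c j) * \<beta> ^ (i - n + j))"
        by (simp add: n sum_distrib_left power_add mult_ac)
      finally have "of_nat d * \<beta> ^ i = (\<Sum>j<n. of_int (c j) * (of_nat d * \<beta> ^ (i - n + j)))"
        by (simp add: sum_distrib_left mult_ac)
      also have "\<dots> \<in> \<Lambda>"
        using False by (intro Lambda_sum Lambda_mult_int less) auto
      finally show ?thesis .
    qed (use d in blast)
  qed
  have "of_nat d * x \<in> \<Lambda>" if "x \<in> int_adjoin \<beta>" for x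
  proof -
    obtain p :: "int poly" where "x = poly (map_poly of_int p) \<beta>"
      using \<open>x \<in> int_adjoin \<beta>\<close> by (auto simp: int_adjoin_iff)
    hence "of_nat d * x =
      (\<Sum>i\<le>degree (map_poly of_int p :: real poly). of_int (coeff p i) * (of_nat d * \<beta> ^ i))"
      by (simp add: poly_altdef coeff_map_poly sum_distrib_left mult_ac)
    also have "\<dots> \<in> \<Lambda>" by (intro Lambda_sum Lambda_mult_int pow)
    finally show ?thesis .
  qed
  thus ?thesis using that d(1) by blast
qed

lemma int_adjoin_in_K:
  assumes "x \<in> int_adjoin \<beta>"
  shows "x \<in> K"
proof -
  obtain p :: "int poly" where "x = poly (map_poly of_int p) \<beta>"
    using assms by (auto simp: int_adjoin_iff)
  moreover have "poly (map_poly of_int p) \<beta> \<in> K"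
    by (induction p) (simp_all add: map_poly_pCons K_add K_mult beta_in_K)
  ultimately show ?thesis by simp
qed

text \<open>All powers of \<open>r\<close> share the denominator \<open>d\<close>; for
  \<open>r < 1\<close> some \<open>d * r ^ k\<close> would be an integer strictly between 0 and
  1.\<close>

lemma int_adjoin_rational:
  assumes "r \<in> \<rat>" "r \<in> int_adjoin \<beta>" "0 < r"
  shows "1 \<le> r"
proof (rule ccontr)
  assume "\<not> 1 \<le> r"
  obtain d where d: "d > 0" "\<And>x. x \<in> int_adjoin \<beta> \<Longrightarrow> of_nat d * x \<in> \<Lambda>"
    using common_denominator by blast
  have "1 / of_nat d > (0 :: real)" using d(1) by simp
  then obtain k where k: "r ^ k < 1 / of_nat d"
    using real_arch_pow_inv[of "1 / of_nat d" r] \<open>\<not> 1 \<le> r\<close> by auto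
  have "of_nat d * r ^ k \<in> \<Lambda>" by (intro d(2) int_adjoin_power assms)
  then obtain a b c :: int where abc: "of_nat d * r ^ k = of_int a + of_int b * \<beta> + of_int c * \<beta> ^ 2"
    by (auto simp: \<Lambda>_def)
  hence "(of_int a - of_nat d * r ^ k) + of_int b * \<beta> + of_int c * \<beta> ^ 2 = 0" by simp
  hence "of_int a - of_nat d * r ^ k = 0"
    using independent[of "of_int a - of_nat d * r ^ k" "of_int b" "of_int c"] assms(1) by simp
  hence a: "of_int a = of_nat d * r ^ k" by simp
  have "of_int a > (0 :: real)" unfolding a using d(1) assms(3) by simp
  moreover have "of_int a < (1 :: real)" unfolding a using k d(1) by (simp add: field_simps)
  ultimately show False by simp
qed

text \<open>The three integer coordinates of \<open>d * x\<close> solve a real linear system given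
  by the element and the real and imaginary part of its conjugate, so bounds on these bound the
  coordinates.\<close>

lemma int_adjoin_discrete: "finite {x \<in> int_adjoin \<beta>. \<bar>x\<bar> \<le> A \<and> cmod (\<sigma> x) \<le> B}"
proof -
  obtain d where d: "d > 0" "\<And>x. x \<in> int_adjoin \<beta> \<Longrightarrow> of_nat d * x \<in> \<Lambda>"
    using common_denominator by blast
  define u v where "u = Re (\<sigma> \<beta>)" and "v = Im (\<sigma> \<beta>)"
  have "v \<noteq> 0" using sigma_nonreal by (simp add: complex_is_Real_iff v_def)
  have Im_sq: "Im (\<sigma> \<beta> ^ 2) = 2 * u * v" and Re_sq: "Re (\<sigma> \<beta> ^ 2) = u ^ 2 - v ^ 2"
    by (simp_all add: power2_eq_square u_def v_def)
  \<comment> \<open>The squared distance between \<beta> and its conjugate. Eliminating a and b from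
    the system leaves c D; \<open>M1\<close>, \<open>M2\<close>, \<open>M3\<close> then bound c, b,
    a by back substitution.\<close>
  define D where "D = (\<beta> - u) ^ 2 + v ^ 2"
  have "D > 0" using \<open>v \<noteq> 0\<close> by (simp add: D_def add_nonneg_pos)
  define A' B' where "A' = of_nat d * A" and "B' = of_nat d * B"
  define M1 where "M1 = (A' + B' + \<bar>\<beta> - u\<bar> * (B' / \<bar>v\<bar>)) / D"
  define M2 where "M2 = B' / \<bar>v\<bar> + 2 * \<bar>u\<bar> * M1"
  define M3 where "M3 = A' + M2 * \<beta> + M1 * \<beta> ^ 2"
  define Z where "Z = (\<lambda>M. {a::int. \<bar>of_int a :: real\<bar> \<le> M})"
  have "{x \<in> int_adjoin \<beta>. \<bar>x\<bar> \<le> A \<and> cmod (\<sigma> x) \<le> B} \<subseteq>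
        (\<lambda>(a, b, c). (of_int a + of_int b * \<beta> + of_int c * \<beta> ^ 2) / of_nat d) ` (Z M3 \<times> Z M2 \<times> Z M1)"
  proof
    fix x assume x: "x \<in> {x \<in> int_adjoin \<beta>. \<bar>x\<bar> \<le> A \<and> cmod (\<sigma> x) \<le> B}"
    define y where "y = of_nat d * x"
    have "y \<in> \<Lambda>" using d x by (simp add: y_def)
    then obtain a b c :: int where y: "y = of_int a + of_int b * \<beta> + of_int c * \<beta> ^ 2"
      by (auto simp: \<Lambda>_def)
    define w where "w = \<sigma> y"
    have w: "w = of_int a + of_int b * \<sigma> \<beta> + of_int c * \<sigma> \<beta> ^ 2"
      unfolding w_def y using sigma_combination(2)[of "of_int a" "of_int b" "of_int c"] by simp
    have y_le: "\<bar>y\<bar> \<le> A'" using x d(1) by (simp add: y_def A'_def abs_mult mult_left_mono)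
    have "w = of_nat d * \<sigma> x" using x int_adjoin_in_K by (simp add: w_def y_def sigma_mult)
    hence "cmod w \<le> B'" using x by (simp add: B'_def norm_mult mult_left_mono)
    hence Re_le: "\<bar>Re w\<bar> \<le> B'" and Im_le: "\<bar>Im w\<bar> \<le> B'"
      using abs_Re_le_cmod[of w] abs_Im_le_cmod[of w] by linarith+
    have Im_w: "Im w / v = of_int b + 2 * of_int c * u"
      using \<open>v \<noteq> 0\<close> by (simp add: w Im_sq field_simps flip: v_def)
    have Re_w: "Re w = of_int a + of_int b * u + of_int c * (u ^ 2 - v ^ 2)"
      by (simp add: w Re_sq flip: u_def)
    have Im_v_le: "\<bar>Im w / v\<bar> \<le> B' / \<bar>v\<bar>"
      using Im_le by (simp add: divide_right_mono)
    have "of_int c * D = (y - Re w) - (\<beta> - u) * (Im w / v)"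
      unfolding Im_w Re_w y D_def by (simp add: algebra_simps power2_eq_square)
    hence c: "of_int c = ((y - Re w) - (\<beta> - u) * (Im w / v)) / D"
      using \<open>D > 0\<close> by (simp add: field_simps)
    have "\<bar>(y - Re w) - (\<beta> - u) * (Im w / v)\<bar> \<le> A' + B' + \<bar>\<beta> - u\<bar> * (B' / \<bar>v\<bar>)"
    proof -
      have "\<bar>(\<beta> - u) * (Im w / v)\<bar> \<le> \<bar>\<beta> - u\<bar> * (B' / \<bar>v\<bar>)"
        unfolding abs_mult by (intro mult_left_mono Im_v_le) simp
      thus ?thesis using y_le Re_le by linarith
    qed
    hence c_le: "\<bar>of_int c :: real\<bar> \<le> M1"
      unfolding c M1_def abs_divide using \<open>D > 0\<close> by (simp add: divide_right_mono)
    have b: "of_int b = Im w / v - 2 * u * of_int c" by (simp add: Im_w)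
    have "\<bar>2 * u * of_int c\<bar> \<le> 2 * \<bar>u\<bar> * M1"
      unfolding abs_mult using c_le by (intro mult_mono) auto
    hence b_le: "\<bar>of_int b :: real\<bar> \<le> M2" unfolding b M2_def using Im_v_le by linarith
    have a: "of_int a = y - of_int b * \<beta> - of_int c * \<beta> ^ 2" by (simp add: y)
    have "\<bar>of_int b * \<beta>\<bar> \<le> M2 * \<beta>" "\<bar>of_int c * \<beta> ^ 2\<bar> \<le> M1 * \<beta> ^ 2"
      using b_le c_le beta_gt_1 by (simp_all add: abs_mult)
    hence a_le: "\<bar>of_int a :: real\<bar> \<le> M3" unfolding a M3_def using y_le by linarith
    have "x = (of_int a + of_int b * \<beta> + of_int c * \<beta> ^ 2) / of_nat d"
      using d(1) by (simp add: y_def flip: y)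
    thus "x \<in> (\<lambda>(a, b, c). (of_int a + of_int b * \<beta> + of_int c * \<beta> ^ 2) / of_nat d) ` (Z M3 \<times> Z M2 \<times> Z M1)"
      using a_le b_le c_le by (intro image_eqI[of _ _ "(a, b, c)"]) (auto simp: Z_def)
  qed
  moreover have "finite (Z M)" for M unfolding Z_def by (rule finite_int_abs_le)
  ultimately show ?thesis by (meson finite_SigmaI finite_imageI finite_subset)
qed

end

text \<open>The elements with real image form a subfield; if \<open>x\<close> were among them, it
  would be all of \<open>rat_adjoin x\<close>.\<close>

lemma nonreal_embedding:
  assumes "\<not> totally_real (rat_adjoin x)"
  obtains \<sigma> where "field_embedding (rat_adjoin x) \<sigma>" "\<sigma> x \<notin> \<real>"
proof -
  obtain \<sigma> where \<sigma>: "field_embedding (rat_adjoin x) \<sigma>" "\<not> \<sigma> ` rat_adjoin x \<subseteq> \<real>"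
    using assms by (auto simp: totally_real_def)
  interpret subfield_embedding "rat_adjoin x" \<sigma>
    by unfold_locales (use is_subfield_rat_adjoin \<sigma> in auto)
  have "\<sigma> x \<notin> \<real>"
  proof
    assume real: "\<sigma> x \<in> \<real>"
    have inv: "\<sigma> (inverse y) \<in> \<real>" if "y \<in> rat_adjoin x" "\<sigma> y \<in> \<real>" for y
    proof (cases "y = 0")
      case False
      hence "\<sigma> (inverse y) = 1 / \<sigma> y"
        using sigma_divide[of 1 y] that by (simp add: inverse_eq_divide)
      thus ?thesis using that by simp
    qed simp
    have "is_subfield {y \<in> rat_adjoin x. \<sigma> y \<in> \<real>}"
      using inv
      by (auto simp: is_subfield_def K_add K_mult K_uminus K_inverse sigma_add sigma_mult sigma_uminus)
    hence "rat_adjoin x \<subseteq> {y \<in> rat_adjoin x. \<sigma> y \<in> \<real>}"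
      using real self_in_rat_adjoin
      by (subst rat_adjoin_def, intro hull_minimal) auto
    thus False using \<sigma>(2) by auto
  qed
  thus ?thesis using that \<sigma>(1) by blast
qed

theorem theorem1p2:
  fixes \<beta> :: real
  assumes "pisot_unit \<beta>"
    and "degree (min_rat_poly \<beta>) = 3"
    and "property_F \<beta>"
    and "\<not> totally_real (rat_adjoin \<beta>)"
  shows "gamma_beta \<beta> \<notin> \<rat> \<and> 0 < gamma_beta \<beta> \<and> gamma_beta \<beta> < 1"
proof -
  define m where "m = min_rat_poly \<beta>"
  have pisot: "pisot_number \<beta>" and int: "algebraic_int \<beta>" and gt_1: "\<beta> > 1"
    using assms(1) by (auto simp: pisot_unit_def pisot_number_def)
  have m: "lead_coeff m = 1" "degree m = 3" "rpoly m \<beta> = 0"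
    using min_rat_poly[OF int] assms(2) by (simp_all add: m_def)
  obtain \<sigma> where \<sigma>: "field_embedding (rat_adjoin \<beta>) \<sigma>" "\<sigma> \<beta> \<notin> \<real>"
    using nonreal_embedding[OF assms(4)] .
  interpret subfield_embedding "rat_adjoin \<beta>" \<sigma>
    by unfold_locales (fact is_subfield_rat_adjoin \<sigma>(1))+
  interpret cubic_embedding "rat_adjoin \<beta>" \<sigma> \<beta>
  proof unfold_locales
    show "\<beta> \<in> rat_adjoin \<beta>" by (rule self_in_rat_adjoin)
    show "cmod (\<sigma> \<beta>) < 1"
    proof -
      \<comment> \<open>An embedding sends \<beta> to a root of its minimal polynomial; being
        non-real, it is a proper conjugate, to which the Pisot condition applies.\<close>
      have "rpoly m (\<sigma> \<beta>) = 0"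
        using sigma_rpoly(2)[OF self_in_rat_adjoin, of m] m(3) by simp
      hence "\<sigma> \<beta> \<in> galois_conjugates \<beta> - {of_real \<beta>}"
        using \<sigma>(2) by (auto simp: galois_conjugates_def m_def)
      thus ?thesis using pisot by (auto simp: pisot_number_def)
    qed
    show "a = 0 \<and> b = 0 \<and> c = 0"
      if "a \<in> \<rat>" "b \<in> \<rat>" "c \<in> \<rat>" "a + b * \<beta> + c * \<beta> ^ 2 = 0" for a b c
    proof -
      obtain a' b' c' where abc: "a = of_rat a'" "b = of_rat b'" "c = of_rat c'"
        using \<open>a \<in> \<rat>\<close> \<open>b \<in> \<rat>\<close> \<open>c \<in> \<rat>\<close> by (auto elim!: Rats_cases)
      have "rpoly [:a', b', c':] \<beta> = 0"
        using that(4) by (simp add: rpoly_pCons abc algebra_simps power2_eq_square)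
      hence "m dvd [:a', b', c':]" unfolding m_def by (rule min_rat_poly(3)[OF int])
      moreover have "degree [:a', b', c':] < degree m" using m(2) by simp
      ultimately have "[:a', b', c':] = 0" using dvd_imp_degree_le[of m "[:a', b', c':]"] by linarith
      thus ?thesis by (simp add: abc)
    qed
    have "(0 :: real) = (\<Sum>i\<le>3. of_rat (coeff m i) * \<beta> ^ i)"
      using m(2,3) by (simp add: poly_altdef coeff_map_poly degree_map_poly)
    also have "\<dots> = of_rat (coeff m 0) + of_rat (coeff m 1) * \<beta> + of_rat (coeff m 2) * \<beta> ^ 2 + \<beta> ^ 3"
      using m(1,2) by (simp add: eval_nat_numeral)
    finally have "\<beta> ^ 3 = of_rat (- coeff m 0) + of_rat (- coeff m 1) * \<beta> + of_rat (- coeff m 2) * \<beta> ^ 2"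
      by (simp add: of_rat_minus)
    thus "\<exists>a\<in>\<rat>. \<exists>b\<in>\<rat>. \<exists>c\<in>\<rat>. \<beta> ^ 3 = a + b * \<beta> + c * \<beta> ^ 2"
      using Rats_of_rat by blast
  qed (use int gt_1 \<sigma>(2) in auto)
  have inverse: "1 / \<beta> \<in> int_adjoin \<beta>"
  proof -
    obtain y where "algebraic_int y" "\<beta> * y = 1"
      using assms(1) by (auto simp: pisot_unit_def ring_of_integers_def)
    moreover from this have "1 / \<beta> = y" using gt_1 by (simp add: field_simps)
    ultimately show ?thesis using algebraic_int_in_adjoin_inverse by simp
  qed
  \<comment> \<open>Property (F) is stated for Z[1/\<beta>], while the lattice argument lives in
    Z[\<beta>].\<close>
  have "\<beta> \<in> int_adjoin (1 / \<beta>)"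
    using gt_1 by (intro algebraic_int_in_adjoin_inverse[OF int]) simp
  hence adjoin_subset: "int_adjoin \<beta> \<subseteq> int_adjoin (1 / \<beta>)" by (rule int_adjoin_subset)
  interpret beta_embedding "rat_adjoin \<beta>" \<sigma> \<beta> "int_adjoin \<beta>"
  proof unfold_locales
    show "int_adjoin \<beta> \<subseteq> rat_adjoin \<beta>" using int_adjoin_in_K by blast
    show "1 \<in> int_adjoin \<beta>" using int_adjoin_of_int[of 1 \<beta>] by simp
    show "\<exists>n. (beta_transformation \<beta> ^^ n) x = 0" if "x \<in> int_adjoin \<beta>" "0 \<le> x" "x < 1" for x
      using property_F_finite_orbit[OF assms(3) gt_1] adjoin_subset that by blast
    show "finite {x \<in> int_adjoin \<beta>. \<bar>x\<bar> \<le> A \<and> cmod (\<sigma> x) \<le> B}" for A B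
      by (rule int_adjoin_discrete)
  qed (use gt_1 inverse sigma_less_1 power_nonreal int_adjoin_rational in
        \<open>auto intro: int_adjoin_add int_adjoin_mult int_adjoin_uminus\<close>)
  show ?thesis by (rule gamma_beta_irrational)
qed

end
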